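(* For all integers $n$ and $k$ with $3\le k\le n$, there exists a smooth closed embedded hypersurface in $\mathbb{R}^{n+1}$ which, for a suitable choice of unit normal, satisfies $\sigma_k\ge 0$ everywhere but is not mean convex, in the sense that $\sigma_1$ changes signs (takes both positive and negative values).
   Context: "Closed" means compact without boundary. For a hypersurface $M\subset\mathbb{R}^{n+1}$ with principal curvatures $\kappa_1,\dots,\kappa_n$ (with respect to a unit normal field), the $k$th mean curvature is $\sigma_k=\sum_{1\le i_1<\cdots<i_k\le n}\kappa_{i_1}\cdots\kappa_{i_k}$; in particular $\sigma_1$ is the mean curvature. *)

theory Defs
  imports "HOL-Analysis.Analysis"
begin

primrec Ck_on :: "nat \<Rightarrow> 'a::euclidean_space set \<Rightarrow> ('a \<Rightarrow> 'b::euclidean_space) \<Rightarrow> bool" where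
  "Ck_on 0 U f \<longleftrightarrow> continuous_on U f"
| "Ck_on (Suc k) U f \<longleftrightarrow>
     (\<forall>x\<in>U. f differentiable (at x)) \<and>
     (\<forall>v. Ck_on k U (\<lambda>x. frechet_derivative f (at x) v))"

definition smooth_on :: "'a::euclidean_space set \<Rightarrow> ('a \<Rightarrow> 'b::euclidean_space) \<Rightarrow> bool" where
  "smooth_on U f \<longleftrightarrow> open U \<and> (\<forall>k. Ck_on k U f)"

(* Codimension-one embedded submanifold without boundary, by slice charts: near each of its
   points M is straightened to a coordinate hyperplane by a diffeomorphism of open subsets of
   the ambient space. *)
definition smooth_hypersurface :: "'a::euclidean_space set \<Rightarrow> bool" where
  "smooth_hypersurface M \<longleftrightarrow>
     (\<forall>p\<in>M. \<exists>U V \<phi> \<psi>. \<exists>b\<in>(Basis :: 'a set).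
        open U \<and> open V \<and> p \<in> U \<and>
        homeomorphism U V \<phi> \<psi> \<and> smooth_on U \<phi> \<and> smooth_on V \<psi> \<and>
        \<phi> ` (M \<inter> U) = {y \<in> V. y \<bullet> b = 0})"

(* Connectedness is required: otherwise, for even k, two disjoint round spheres with opposite
   choices of normal would have sigma_k > 0 and sigma_1 of both signs. *)
definition closed_hypersurface :: "'a::euclidean_space set \<Rightarrow> bool" where
  "closed_hypersurface M \<longleftrightarrow> smooth_hypersurface M \<and> compact M \<and> connected M"

definition tangent_space :: "'a::euclidean_space set \<Rightarrow> 'a \<Rightarrow> 'a set" where
  "tangent_space M p = {v. \<exists>\<gamma> \<epsilon>. 0 < \<epsilon> \<and> smooth_on {-\<epsilon><..<\<epsilon>} \<gamma> \<and>
     \<gamma> ` {-\<epsilon><..<\<epsilon>} \<subseteq> M \<and> \<gamma> 0 = p \<and> (\<gamma> has_vector_derivative v) (at (0::real))}"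

(* Smoothness of a map on M is expressed by a smooth extension to a neighbourhood of M; the
   values of the extension off M do not affect its derivatives in tangential directions. *)
definition unit_normal_field :: "'a::euclidean_space set \<Rightarrow> ('a \<Rightarrow> 'a) \<Rightarrow> bool" where
  "unit_normal_field M \<nu> \<longleftrightarrow>
     (\<exists>U. M \<subseteq> U \<and> smooth_on U \<nu>) \<and>
     (\<forall>p\<in>M. norm (\<nu> p) = 1 \<and> (\<forall>v\<in>tangent_space M p. \<nu> p \<bullet> v = 0))"

definition shape_operator :: "('a::euclidean_space \<Rightarrow> 'a) \<Rightarrow> 'a \<Rightarrow> 'a \<Rightarrow> 'a" where
  "shape_operator \<nu> p v = - frechet_derivative \<nu> (at p) v"

(* The family kappa_1, ..., kappa_n, n = DIM('a) - 1, lists the eigenvalues, with multiplicity,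
   of the shape operator on the tangent space: it diagonalizes in an orthonormal basis e. *)
definition principal_curvatures ::
    "'a::euclidean_space set \<Rightarrow> ('a \<Rightarrow> 'a) \<Rightarrow> 'a \<Rightarrow> (nat \<Rightarrow> real) \<Rightarrow> bool" where
  "principal_curvatures M \<nu> p \<kappa> \<longleftrightarrow>
     (\<exists>e :: nat \<Rightarrow> 'a.
        (\<forall>i\<in>{1..DIM('a) - 1}. \<forall>j\<in>{1..DIM('a) - 1}. e i \<bullet> e j = (if i = j then 1 else 0)) \<and>
        span (e ` {1..DIM('a) - 1}) = tangent_space M p \<and>
        (\<forall>i\<in>{1..DIM('a) - 1}. shape_operator \<nu> p (e i) = \<kappa> i *\<^sub>R e i))"

definition elem_sym :: "nat \<Rightarrow> nat \<Rightarrow> (nat \<Rightarrow> real) \<Rightarrow> real" where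
  "elem_sym n k \<kappa> = (\<Sum>I | I \<subseteq> {1..n} \<and> card I = k. \<Prod>i\<in>I. \<kappa> i)"

(* The principal curvatures are determined up to order, so the choice of their enumeration
   does not matter. *)
definition mean_curvature ::
    "nat \<Rightarrow> 'a::euclidean_space set \<Rightarrow> ('a \<Rightarrow> 'a) \<Rightarrow> 'a \<Rightarrow> real" where
  "mean_curvature k M \<nu> p =
     elem_sym (DIM('a) - 1) k (SOME \<kappa>. principal_curvatures M \<nu> p \<kappa>)"

end

theory Submission
  imports Defs
begin

text \<open>
  The hypersurface is a torus \<open>S\<^sup>p \<times> S\<^sup>q\<close> with \<open>p + q = n\<close>: the boundary of the unit tube around a
  sphere of radius \<open>R > 1\<close> in a coordinate subspace of dimension \<open>p + 1\<close>. With respect to the inward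
  normal, the \<open>q\<close> meridian directions have curvature \<open>1\<close>. The \<open>p\<close> directions along the core sphere have
  curvature \<open>\<lambda> = 1 - R / \<rho>\<close>, where \<open>\<rho>\<close> is the distance to the orthogonal complement of the
  coordinate subspace; it ranges over \<open>[R - 1, R + 1]\<close>. Hence
  \<open>\<sigma>\<^sub>k = (\<Sum>j\<le>k. (p choose j) (q choose (k - j)) \<lambda> ^ j)\<close>, and \<open>\<sigma>\<^sub>1 = q + p \<lambda>\<close>.

  The lowest exponent of \<open>\<lambda>\<close> in \<open>\<sigma>\<^sub>k\<close> is \<open>k - q\<close> when \<open>q \<le> k\<close>. If it is even, \<open>\<sigma>\<^sub>k\<close> stays
  nonnegative when \<open>\<lambda>\<close> becomes slightly negative; the question is whether this lasts until \<open>\<lambda>\<close> passes the zero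
  \<open>- q / p\<close> of \<open>\<sigma>\<^sub>1\<close>. It does for \<open>q = 1\<close> when \<open>k\<close> is odd, and for \<open>q = 2\<close> when \<open>k\<close> is even: in both cases
  \<open>\<sigma>\<^sub>k \<ge> 0\<close> for \<open>\<lambda> \<ge> - q / (p - 1)\<close> (lemmas \<open>sigma_one_meridian_nonneg\<close> and
  \<open>sigma_two_meridian_nonneg\<close>). The radius \<open>R = 1 + (p - 1) / q\<close> makes \<open>- q / (p - 1)\<close> the least value
  of \<open>\<lambda>\<close>, taken on the inner equator \<open>\<rho> = R - 1\<close>, where therefore \<open>\<sigma>\<^sub>1 < 0\<close>. On the outer equator
  \<open>\<sigma>\<^sub>1 > 0\<close>.

  The geometry rests on \<open>graph_slice_chart\<close>, which provides the charts, on \<open>tangent_space_M\<close>, and on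
  \<open>mean_curvature_two_values\<close>, which computes the mean curvatures from a splitting of the tangent
  space into two orthogonal eigenspaces of the shape operator.
\<close>

section \<open>Smooth functions\<close>

lemma Ck_on_cong:
  fixes f g :: "'a::euclidean_space \<Rightarrow> 'b::euclidean_space"
  assumes "open U" "\<And>x. x \<in> U \<Longrightarrow> f x = g x" "Ck_on k U f"
  shows "Ck_on k U g"
  using assms(2,3)
proof (induction k arbitrary: f g)
  case 0
  then show ?case by (metis Ck_on.simps(1) continuous_on_cong)
next
  case (Suc k)
  have D: "(g has_derivative frechet_derivative f (at x)) (at x)" if "x \<in> U" for x
  proof (rule has_derivative_transform_within_open[OF _ \<open>open U\<close> that Suc.prems(1)])
    show "(f has_derivative frechet_derivative f (at x)) (at x)"
      using Suc.prems(2) that by (simp add: frechet_derivative_works)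
  qed
  show ?case
    unfolding Ck_on.simps
  proof (intro conjI ballI allI)
    show "g differentiable (at x)" if "x \<in> U" for x
      using D[OF that] by (auto simp: differentiable_def)
    show "Ck_on k U (\<lambda>x. frechet_derivative g (at x) v)" for v
    proof (rule Suc.IH)
      show "frechet_derivative f (at x) v = frechet_derivative g (at x) v" if "x \<in> U" for x
        using frechet_derivative_at[OF D[OF that]] by simp
      show "Ck_on k U (\<lambda>x. frechet_derivative f (at x) v)"
        using Suc.prems(2) by simp
    qed
  qed
qed

text \<open>For the reciprocal and the square root below, the derivative is a product of factors built
  from derivatives of \<open>f\<close> and the very function under study. This rule then gives its smoothness by
  induction on the order, and no higher chain rule is needed.\<close>

lemma Ck_on_SucI:
  fixes f :: "'a::euclidean_space \<Rightarrow> 'b::euclidean_space"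
  assumes "open U" and D: "\<And>x. x \<in> U \<Longrightarrow> (f has_derivative D x) (at x)"
    and "\<And>v. Ck_on k U (\<lambda>x. D x v)"
  shows "Ck_on (Suc k) U f"
proof -
  have "D x v = frechet_derivative f (at x) v" if "x \<in> U" for x v
    using frechet_derivative_at[OF D[OF that]] by simp
  then have "Ck_on k U (\<lambda>x. frechet_derivative f (at x) v)" for v
    by (rule Ck_on_cong[OF assms(1) _ assms(3)])
  then show ?thesis
    using D by (auto simp: differentiable_def)
qed

lemma Ck_on_SucE:
  fixes f :: "'a::euclidean_space \<Rightarrow> 'b::euclidean_space"
  assumes "Ck_on (Suc k) U f"
  obtains D where "\<And>x. x \<in> U \<Longrightarrow> (f has_derivative D x) (at x)"
    and "\<And>v. Ck_on k U (\<lambda>x. D x v)"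
  using assms that[of "\<lambda>x. frechet_derivative f (at x)"]
  by (simp add: frechet_derivative_works)

lemma Ck_on_Suc_imp_Ck_on:
  fixes f :: "'a::euclidean_space \<Rightarrow> 'b::euclidean_space"
  shows "Ck_on (Suc k) U f \<Longrightarrow> Ck_on k U f"
proof (induction k arbitrary: f)
  case 0
  then show ?case
    by (auto intro: differentiable_imp_continuous_on simp: differentiable_on_def
        differentiable_at_withinI)
next
  case (Suc k)
  then show ?case by (metis Ck_on.simps(2))
qed

lemma Ck_on_const: "open U \<Longrightarrow> Ck_on k U (\<lambda>x. c)"
proof (induction k arbitrary: c)
  case (Suc k)
  show ?case
    by (rule Ck_on_SucI[OF Suc.prems has_derivative_const]) (use Suc in blast)
qed simp

lemma Ck_on_bounded_linear:
  assumes "open U" "bounded_linear f"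
  shows "Ck_on k U f"
proof (cases k)
  case 0
  then show ?thesis using assms by (simp add: linear_continuous_on)
next
  case (Suc m)
  show ?thesis unfolding Suc
    by (rule Ck_on_SucI[OF assms(1) bounded_linear_imp_has_derivative[OF assms(2)]])
      (rule Ck_on_const[OF assms(1)])
qed

lemma Ck_on_add:
  fixes f g :: "'a::euclidean_space \<Rightarrow> 'b::euclidean_space"
  assumes "open U"
  shows "Ck_on k U f \<Longrightarrow> Ck_on k U g \<Longrightarrow> Ck_on k U (\<lambda>x. f x + g x)"
proof (induction k arbitrary: f g)
  case 0
  then show ?case by (simp add: continuous_on_add)
next
  case (Suc k)
  obtain D where D: "\<And>x. x \<in> U \<Longrightarrow> (f has_derivative D x) (at x)" "\<And>v. Ck_on k U (\<lambda>x. D x v)"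
    using Suc.prems(1) by (rule Ck_on_SucE) blast
  obtain E where E: "\<And>x. x \<in> U \<Longrightarrow> (g has_derivative E x) (at x)" "\<And>v. Ck_on k U (\<lambda>x. E x v)"
    using Suc.prems(2) by (rule Ck_on_SucE) blast
  show ?case
    by (rule Ck_on_SucI[OF assms has_derivative_add[OF D(1) E(1)]]) (use D(2) E(2) Suc.IH in auto)
qed

lemma Ck_on_bilinear:
  fixes f :: "'a::euclidean_space \<Rightarrow> 'b::euclidean_space" and g :: "'a \<Rightarrow> 'c::euclidean_space"
    and pr :: "'b \<Rightarrow> 'c \<Rightarrow> 'd::euclidean_space"
  assumes "open U" and bil: "bounded_bilinear pr"
  shows "Ck_on k U f \<Longrightarrow> Ck_on k U g \<Longrightarrow> Ck_on k U (\<lambda>x. pr (f x) (g x))"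
proof (induction k arbitrary: f g)
  case 0
  then show ?case using bounded_bilinear.continuous_on[OF bil] by simp
next
  case (Suc k)
  obtain D where D: "\<And>x. x \<in> U \<Longrightarrow> (f has_derivative D x) (at x)" "\<And>v. Ck_on k U (\<lambda>x. D x v)"
    using Suc.prems(1) by (rule Ck_on_SucE) blast
  obtain E where E: "\<And>x. x \<in> U \<Longrightarrow> (g has_derivative E x) (at x)" "\<And>v. Ck_on k U (\<lambda>x. E x v)"
    using Suc.prems(2) by (rule Ck_on_SucE) blast
  have "Ck_on k U (\<lambda>x. pr (f x) (E x v) + pr (D x v) (g x))" for v
    by (rule Ck_on_add[OF assms(1) Suc.IH[OF Ck_on_Suc_imp_Ck_on[OF Suc.prems(1)] E(2)]
          Suc.IH[OF D(2) Ck_on_Suc_imp_Ck_on[OF Suc.prems(2)]]])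
  then show ?case
    using Ck_on_SucI[OF assms(1) bounded_bilinear.FDERIV[OF bil D(1) E(1)]] by blast
qed

lemma Ck_on_inverse:
  fixes f :: "'a::euclidean_space \<Rightarrow> real"
  assumes "open U" and "\<And>x. x \<in> U \<Longrightarrow> f x \<noteq> 0"
  shows "Ck_on k U f \<Longrightarrow> Ck_on k U (\<lambda>x. inverse (f x))"
proof (induction k)
  case 0
  then show ?case using assms by (simp add: continuous_on_inverse)
next
  case (Suc k)
  obtain D where D: "\<And>x. x \<in> U \<Longrightarrow> (f has_derivative D x) (at x)" "\<And>v. Ck_on k U (\<lambda>x. D x v)"
    using Suc.prems by (rule Ck_on_SucE) blast
  have mult: "Ck_on k U (\<lambda>x. g x * h x)" if "Ck_on k U g" "Ck_on k U h" for g h :: "'a \<Rightarrow> real"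
    by (rule Ck_on_bilinear[OF assms(1) bounded_bilinear_mult that])
  have inv: "Ck_on k U (\<lambda>x. inverse (f x))"
    by (rule Suc.IH[OF Ck_on_Suc_imp_Ck_on[OF Suc.prems]])
  have "((\<lambda>x. inverse (f x)) has_derivative (\<lambda>h. - (inverse (f x) * D x h * inverse (f x)))) (at x)"
    if "x \<in> U" for x
    by (rule Deriv.has_derivative_inverse[OF assms(2)[OF that] D(1)[OF that]])
  moreover have "Ck_on k U (\<lambda>x. - (inverse (f x) * D x v * inverse (f x)))" for v
    using mult[OF Ck_on_const[OF assms(1), of k "-1"] mult[OF mult[OF inv D(2)] inv]] by simp
  ultimately show ?case by (rule Ck_on_SucI[OF assms(1)])
qed

lemma Ck_on_sqrt:
  fixes f :: "'a::euclidean_space \<Rightarrow> real"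
  assumes "open U" and pos: "\<And>x. x \<in> U \<Longrightarrow> f x > 0"
  shows "Ck_on k U f \<Longrightarrow> Ck_on k U (\<lambda>x. sqrt (f x))"
proof (induction k)
  case 0
  then show ?case by (simp add: continuous_on_real_sqrt)
next
  case (Suc k)
  obtain D where D: "\<And>x. x \<in> U \<Longrightarrow> (f has_derivative D x) (at x)" "\<And>v. Ck_on k U (\<lambda>x. D x v)"
    using Suc.prems by (rule Ck_on_SucE) blast
  have mult: "Ck_on k U (\<lambda>x. g x * h x)" if "Ck_on k U g" "Ck_on k U h" for g h :: "'a \<Rightarrow> real"
    by (rule Ck_on_bilinear[OF assms(1) bounded_bilinear_mult that])
  have "Ck_on k U (\<lambda>x. sqrt (f x))"
    by (rule Suc.IH[OF Ck_on_Suc_imp_Ck_on[OF Suc.prems]])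
  then have inv: "Ck_on k U (\<lambda>x. inverse (sqrt (f x)))"
    by (rule Ck_on_inverse[OF assms(1), rotated]) (use pos in force)
  have "((\<lambda>x. sqrt (f x)) has_derivative (\<lambda>h. 1/2 * (D x h * inverse (sqrt (f x))))) (at x)"
    if "x \<in> U" for x
    using has_derivative_real_sqrt[OF pos[OF that] D(1)[OF that]]
    by (simp add: field_simps)
  moreover have "Ck_on k U (\<lambda>x. 1/2 * (D x v * inverse (sqrt (f x))))" for v
    by (rule mult[OF Ck_on_const[OF assms(1)] mult[OF D(2) inv]])
  ultimately show ?case by (rule Ck_on_SucI[OF assms(1)])
qed

lemma smooth_on_open: "smooth_on U f \<Longrightarrow> open U"
  by (simp add: smooth_on_def)

lemma smooth_on_continuous: "smooth_on U f \<Longrightarrow> continuous_on U f"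
  unfolding smooth_on_def by (metis Ck_on.simps(1))

lemma smooth_on_subset:
  assumes "smooth_on U f" "open V" "V \<subseteq> U"
  shows "smooth_on V f"
proof -
  have "Ck_on k U f \<Longrightarrow> Ck_on k V f" for k
    using assms(3) by (induction k arbitrary: f) (auto intro: continuous_on_subset)
  then show ?thesis using assms by (auto simp: smooth_on_def)
qed

lemma smooth_on_const: "open U \<Longrightarrow> smooth_on U (\<lambda>x. c)"
  by (simp add: smooth_on_def Ck_on_const)

lemma smooth_on_bounded_linear: "open U \<Longrightarrow> bounded_linear f \<Longrightarrow> smooth_on U f"
  by (simp add: smooth_on_def Ck_on_bounded_linear)

lemma smooth_on_add: "smooth_on U f \<Longrightarrow> smooth_on U g \<Longrightarrow> smooth_on U (\<lambda>x. f x + g x)"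
  by (simp add: smooth_on_def Ck_on_add)

lemma smooth_on_bilinear:
  "bounded_bilinear pr \<Longrightarrow> smooth_on U f \<Longrightarrow> smooth_on U g \<Longrightarrow> smooth_on U (\<lambda>x. pr (f x) (g x))"
  by (simp add: smooth_on_def Ck_on_bilinear)

lemmas smooth_on_scaleR = smooth_on_bilinear[OF bounded_bilinear_scaleR]
lemmas smooth_on_mult = smooth_on_bilinear[OF bounded_bilinear_mult]
lemmas smooth_on_inner = smooth_on_bilinear[OF bounded_bilinear_inner]

lemma smooth_on_diff:
  assumes "smooth_on U f" "smooth_on U g"
  shows "smooth_on U (\<lambda>x. f x - g x)"
  using smooth_on_add[OF assms(1) smooth_on_scaleR[OF smooth_on_const assms(2), of "-1"]] assms
  by (simp add: smooth_on_def)

lemma smooth_on_sqrt: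
  "smooth_on U f \<Longrightarrow> (\<And>x. x \<in> U \<Longrightarrow> f x > 0) \<Longrightarrow> smooth_on U (\<lambda>x. sqrt (f x))"
  by (simp add: smooth_on_def Ck_on_sqrt)

lemma smooth_on_norm:
  assumes "smooth_on U f" "\<And>x. x \<in> U \<Longrightarrow> f x \<noteq> 0"
  shows "smooth_on U (\<lambda>x. norm (f x))"
  unfolding norm_eq_sqrt_inner
  by (rule smooth_on_sqrt) (use assms smooth_on_inner in auto)

lemma smooth_on_sgn:
  assumes "smooth_on U f" "\<And>x. x \<in> U \<Longrightarrow> f x \<noteq> 0"
  shows "smooth_on U (\<lambda>x. sgn (f x))"
proof -
  have "smooth_on U (\<lambda>x. inverse (norm (f x)))"
    using smooth_on_norm[OF assms] assms(2) by (simp add: smooth_on_def Ck_on_inverse)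
  then show ?thesis
    unfolding sgn_div_norm by (rule smooth_on_scaleR) (rule assms(1))
qed

lemma has_derivative_sgn:
  fixes f :: "'a::real_normed_vector \<Rightarrow> 'b::real_inner"
  assumes "(f has_derivative f') (at x)" and "f x \<noteq> 0"
  shows "((\<lambda>x. sgn (f x)) has_derivative
           (\<lambda>h. (f' h - (sgn (f x) \<bullet> f' h) *\<^sub>R sgn (f x)) /\<^sub>R norm (f x))) (at x)"
proof -
  have nrm: "((\<lambda>x. norm (f x)) has_derivative (\<lambda>h. f' h \<bullet> sgn (f x))) (at x)"
    using has_derivative_compose[OF assms(1) has_derivative_norm[OF assms(2)]] .
  have "((\<lambda>x. f x /\<^sub>R norm (f x)) has_derivative
      (\<lambda>h. inverse (norm (f x)) *\<^sub>R f' h +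
         (- (inverse (norm (f x)) * (f' h \<bullet> sgn (f x)) * inverse (norm (f x)))) *\<^sub>R f x)) (at x)"
    by (rule has_derivative_scaleR[OF Deriv.has_derivative_inverse[OF _ nrm] assms(1)]) (use assms(2) in simp)
  then show ?thesis
    by (simp add: sgn_div_norm algebra_simps inner_commute)
qed

section \<open>Graphs over coordinate hyperplanes\<close>

text \<open>If \<open>g\<close> is invariant under translations along \<open>b\<close>, the shear \<open>x - g x b\<close> has the explicit
  inverse \<open>y + g y b\<close> and turns the graph \<open>x \<bullet> b = g x\<close> into the hyperplane \<open>y \<bullet> b = 0\<close>. So the
  charts need no inverse function theorem.\<close>

lemma graph_slice_chart:
  fixes g :: "'a::euclidean_space \<Rightarrow> real"
  assumes b: "b \<in> Basis" and g: "smooth_on W g" and U: "open U" "U \<subseteq> W" "p \<in> U"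
    and inv: "\<And>x t. x \<in> W \<Longrightarrow> x + t *\<^sub>R b \<in> W \<and> g (x + t *\<^sub>R b) = g x"
    and M: "M \<inter> U = {x \<in> U. x \<bullet> b = g x}"
  shows "\<exists>U V \<phi> \<psi>. \<exists>b\<in>(Basis :: 'a set).
        open U \<and> open V \<and> p \<in> U \<and>
        homeomorphism U V \<phi> \<psi> \<and> smooth_on U \<phi> \<and> smooth_on V \<psi> \<and>
        \<phi> ` (M \<inter> U) = {y \<in> V. y \<bullet> b = 0}"
proof -
  define \<phi> \<psi> where "\<phi> = (\<lambda>x. x - g x *\<^sub>R b)" and "\<psi> = (\<lambda>y. y + g y *\<^sub>R b)"
  define V where "V = {y \<in> W. \<psi> y \<in> U}"
  have W: "open W" using g by (rule smooth_on_open)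
  have id: "smooth_on W (\<lambda>x. x)"
    by (rule smooth_on_bounded_linear[OF W bounded_linear_ident])
  have gb: "smooth_on W (\<lambda>x. g x *\<^sub>R b)"
    by (rule smooth_on_scaleR[OF g smooth_on_const[OF W]])
  have sm: "smooth_on W \<phi>" "smooth_on W \<psi>"
    unfolding \<phi>_def \<psi>_def by (rule smooth_on_diff[OF id gb], rule smooth_on_add[OF id gb])
  have "open V"
    unfolding V_def using continuous_open_preimage[OF smooth_on_continuous[OF sm(2)] W U(1)]
    by (simp add: vimage_def Int_def)
  have inv': "x - t *\<^sub>R b \<in> W \<and> g (x - t *\<^sub>R b) = g x" if "x \<in> W" for x t
    using inv[OF that, of "-t"] by simp
  have \<phi>\<psi>: "\<phi> (\<psi> y) = y" if "y \<in> W" for y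
    using inv[OF that] by (simp add: \<phi>_def \<psi>_def)
  have \<psi>\<phi>: "\<psi> (\<phi> x) = x" if "x \<in> W" for x
    using inv'[OF that] by (simp add: \<phi>_def \<psi>_def)
  have \<phi>V: "\<phi> x \<in> V" if "x \<in> U" for x
    using that U \<psi>\<phi> inv' by (auto simp: V_def \<phi>_def subset_iff)
  have VW: "V \<subseteq> W" by (auto simp: V_def)
  have "homeomorphism U V \<phi> \<psi>"
    by (rule homeomorphismI)
      (use sm U VW \<phi>V \<phi>\<psi> \<psi>\<phi> in \<open>auto simp: V_def intro: continuous_on_subset smooth_on_continuous\<close>)
  moreover have "\<phi> ` (M \<inter> U) = {y \<in> V. y \<bullet> b = 0}"
  proof (intro equalityI subsetI)
    fix y assume "y \<in> \<phi> ` (M \<inter> U)"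
    then show "y \<in> {y \<in> V. y \<bullet> b = 0}"
      using \<phi>V b unfolding M by (auto simp: \<phi>_def inner_diff_left)
  next
    fix y assume y: "y \<in> {y \<in> V. y \<bullet> b = 0}"
    then have "\<psi> y \<in> M \<inter> U"
      unfolding M using inv b by (auto simp: V_def \<psi>_def inner_add_left)
    then show "y \<in> \<phi> ` (M \<inter> U)"
      using \<phi>\<psi>[of y] y by (metis (mono_tags, lifting) V_def image_eqI mem_Collect_eq)
  qed
  ultimately show ?thesis
    using smooth_on_subset[OF sm(1) U(1,2)] smooth_on_subset[OF sm(2) \<open>open V\<close> VW]
      U \<open>open V\<close> b by blast
qed

section \<open>Mean curvatures for two principal curvature values\<close>

text \<open>The right-hand side is the coefficient of \<open>t ^ k\<close> in \<open>(1 + b t) ^ p (1 + t) ^ q\<close>: a set of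
  \<open>k\<close> indices splits into its parts inside and outside \<open>J\<close>.\<close>

lemma elem_sym_two_values:
  assumes J: "J \<subseteq> {1..n}" "card J = p" and n: "n = p + q"
    and b: "\<And>i. i \<in> J \<Longrightarrow> \<kappa> i = b" and 1: "\<And>i. i \<in> {1..n} - J \<Longrightarrow> \<kappa> i = 1"
  shows "elem_sym n k \<kappa> = (\<Sum>j\<le>k. real (p choose j) * real (q choose (k - j)) * b ^ j)"
proof -
  define J' where "J' = {1..n} - J"
  define X where "X = {I. I \<subseteq> {1..n} \<and> card I = k}"
  have fin: "finite J" "finite J'" and J': "card J' = q" and disj: "J \<inter> J' = {}" "J \<union> J' = {1..n}"
    using J n by (auto simp: J'_def card_Diff_subset finite_subset)
  have finX: "finite X" by (simp add: X_def)
  have subX: "finite I" "card I = k" "card (I \<inter> J) \<le> k" if "I \<in> X" for I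
    using that by (auto simp: X_def intro: finite_subset card_mono)
  have prod: "(\<Prod>i\<in>I. \<kappa> i) = b ^ card (I \<inter> J)" if "I \<in> X" for I
  proof -
    have "(\<Prod>i\<in>I. \<kappa> i) = (\<Prod>i\<in>I. if i \<in> J then b else 1)"
      by (rule prod.cong) (use b 1 that in \<open>auto simp: X_def\<close>)
    also have "\<dots> = (\<Prod>i\<in>I \<inter> J. b)"
      by (rule prod.inter_restrict[OF subX(1)[OF that], symmetric])
    finally show ?thesis by simp
  qed
  have count: "card {I \<in> X. card (I \<inter> J) = j} = (p choose j) * (q choose (k - j))" if "j \<le> k" for j
  proof -
    define Y where "Y = {K. K \<subseteq> J \<and> card K = j} \<times> {K. K \<subseteq> J' \<and> card K = k - j}"
    have "bij_betw (\<lambda>(K, K'). K \<union> K') Y {I \<in> X. card (I \<inter> J) = j}"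
    proof (rule bij_betwI[where g = "\<lambda>I. (I \<inter> J, I \<inter> J')"])
      show "(\<lambda>(K, K'). K \<union> K') \<in> Y \<rightarrow> {I \<in> X. card (I \<inter> J) = j}"
      proof (clarsimp simp: Y_def X_def)
        fix K K' assume K: "K \<subseteq> J" "j = card K" "K' \<subseteq> J'" "card K' = k - card K"
        have "finite K" "finite K'" "K \<inter> K' = {}" "(K \<union> K') \<inter> J = K"
          using K fin disj by (auto intro: finite_subset)
        then show "K \<subseteq> {Suc 0..n} \<and> K' \<subseteq> {Suc 0..n} \<and> card (K \<union> K') = k \<and>
            card ((K \<union> K') \<inter> J) = card K"
          using K disj(2) that by (auto simp: card_Un_disjoint)
      qed
      show "(\<lambda>I. (I \<inter> J, I \<inter> J')) \<in> {I \<in> X. card (I \<inter> J) = j} \<rightarrow> Y"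
      proof (clarsimp simp: Y_def)
        fix I assume I: "I \<in> X"
        have "I = (I \<inter> J) \<union> (I \<inter> J')" using I disj by (auto simp: X_def)
        then have "card I = card (I \<inter> J) + card (I \<inter> J')"
          using card_Un_disjoint[of "I \<inter> J" "I \<inter> J'"] fin disj by auto
        then show "card (I \<inter> J') = k - card (I \<inter> J)" using subX(2)[OF I] by simp
      qed
      show "((case KK of (K, K') \<Rightarrow> K \<union> K') \<inter> J, (case KK of (K, K') \<Rightarrow> K \<union> K') \<inter> J') = KK"
        if "KK \<in> Y" for KK using that disj by (auto simp: Y_def)
      show "(case (I \<inter> J, I \<inter> J') of (K, K') \<Rightarrow> K \<union> K') = I" if "I \<in> {I \<in> X. card (I \<inter> J) = j}" for I
        using that disj by (auto simp: X_def)
    qed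
    then have "card {I \<in> X. card (I \<inter> J) = j} = card Y" by (simp add: bij_betw_same_card)
    also have "\<dots> = (p choose j) * (q choose (k - j))"
      unfolding Y_def using fin J J' by (simp add: card_cartesian_product n_subsets)
    finally show ?thesis .
  qed
  have "elem_sym n k \<kappa> = (\<Sum>I\<in>X. b ^ card (I \<inter> J))"
    unfolding elem_sym_def X_def[symmetric] by (rule sum.cong) (use prod in auto)
  also have "\<dots> = (\<Sum>j\<le>k. \<Sum>I\<in>{I \<in> X. card (I \<inter> J) = j}. b ^ card (I \<inter> J))"
    by (rule sum.group[symmetric]) (use finX subX in auto)
  also have "\<dots> = (\<Sum>j\<le>k. real (p choose j) * real (q choose (k - j)) * b ^ j)"
    by (rule sum.cong) (use count in auto)
  finally show ?thesis .
qed

lemma orthonormal_family: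
  fixes e :: "'i \<Rightarrow> 'a::euclidean_space"
  assumes e: "\<And>i j. i \<in> I \<Longrightarrow> j \<in> I \<Longrightarrow> e i \<bullet> e j = (if i = j then 1 else 0)"
  shows "inj_on e I" and "independent (e ` I)"
proof -
  show "inj_on e I"
    using e by (intro inj_onI) (metis zero_neq_one)
  have "pairwise orthogonal (e ` I)" "0 \<notin> e ` I"
    using e by (auto simp: pairwise_def orthogonal_def) (metis inner_zero_left zero_neq_one)
  then show "independent (e ` I)" by (rule pairwise_orthogonal_independent)
qed

text \<open>Two things have to be shown, since the principal curvatures are chosen: that some orthonormal
  eigenbasis exists (join orthonormal bases of \<open>E\<close> and \<open>F\<close>), and that every choice has the same
  multiplicities. For the latter, each eigenvector lies in \<open>E\<close> or in \<open>F\<close>; orthonormality bounds the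
  number of those in either space by its dimension, and the two bounds add up to the number of
  eigenvectors, so both are attained.\<close>

lemma mean_curvature_two_values:
  fixes M :: "'a::euclidean_space set"
  assumes T: "tangent_space M x = T" "subspace T" and E: "subspace E" "E \<subseteq> T"
    and F: "F = {v \<in> T. \<forall>u\<in>E. orthogonal u v}"
    and dims: "dim E = p" "dim F = q" "DIM('a) - 1 = p + q"
    and lin: "linear (shape_operator \<nu> x)"
    and SE: "\<And>v. v \<in> E \<Longrightarrow> shape_operator \<nu> x v = b *\<^sub>R v"
    and SF: "\<And>v. v \<in> F \<Longrightarrow> shape_operator \<nu> x v = v" and b: "b \<noteq> 1"
  shows "mean_curvature k M \<nu> x = (\<Sum>j\<le>k. real (p choose j) * real (q choose (k - j)) * b ^ j)"
proof -
  let ?n = "DIM('a) - 1"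
  have subF: "subspace F"
    unfolding F subspace_def using T(2)
    by (auto simp: subspace_0 subspace_add subspace_scale orthogonal_clauses)
  have dimT: "dim T = ?n"
    using dim_subspace_orthogonal_to_vectors[OF E(1) T(2) E(2)] dims by (simp add: F)
  have "\<exists>\<kappa>. principal_curvatures M \<nu> x \<kappa>"
  proof -
    obtain C where C: "C \<subseteq> E" "pairwise orthogonal C" "\<And>x. x \<in> C \<Longrightarrow> norm x = 1"
        "independent C" "card C = dim E"
      by (rule orthonormal_basis_subspace[OF E(1)]) blast
    obtain D where D: "D \<subseteq> F" "pairwise orthogonal D" "\<And>x. x \<in> D \<Longrightarrow> norm x = 1"
        "independent D" "card D = dim F"
      by (rule orthonormal_basis_subspace[OF subF]) blast
    have orth: "u \<bullet> v = 0" if "u \<in> C" "v \<in> D" for u v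
      using that C(1) D(1) unfolding F orthogonal_def by auto
    have disj: "C \<inter> D = {}" using orth C(3) by fastforce
    have fin: "finite C" "finite D" using C(4) D(4) by (auto intro: independent_imp_finite)
    have card: "card (C \<union> D) = ?n" using fin disj C(5) D(5) dims by (simp add: card_Un_disjoint)
    have onb: "u \<bullet> v = (if u = v then 1 else 0)" if "u \<in> C \<union> D" "v \<in> C \<union> D" for u v
    proof (cases "u = v")
      case True
      then show ?thesis using that C(3) D(3) by (auto simp: norm_eq_1)
    next
      case False
      then have "u \<bullet> v = 0"
        using that orth[of u v] orth[of v u] C(2) D(2)
        by (auto simp: pairwise_def orthogonal_def inner_commute[of v u])
      then show ?thesis using False by simp
    qed
    have "independent (C \<union> D)"
      using orthonormal_family(2)[of "C \<union> D" "\<lambda>x. x"] onb by simp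
    moreover have sub: "C \<union> D \<subseteq> T" using C(1) D(1) E(2) by (auto simp: F)
    ultimately have "T \<subseteq> span (C \<union> D)"
      using card_eq_dim[of "C \<union> D" T] card dimT fin by simp
    then have span: "span (C \<union> D) = T" using sub T(2) by (simp add: span_minimal subset_antisym)
    obtain e where e: "bij_betw e {1..?n} (C \<union> D)"
      using ex_bij_betw_nat_finite_1[of "C \<union> D"] fin card by auto
    have "principal_curvatures M \<nu> x (\<lambda>i. if e i \<in> C then b else 1)"
      unfolding principal_curvatures_def
    proof (intro exI[of _ e] conjI ballI)
      show "e i \<bullet> e j = (if i = j then 1 else 0)" if "i \<in> {1..?n}" "j \<in> {1..?n}" for i j
        using onb[of "e i" "e j"] that bij_betw_apply[OF e] bij_betw_imp_inj_on[OF e]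
        by (auto simp: inj_on_eq_iff)
      show "span (e ` {1..?n}) = tangent_space M x"
        using span e T(1) by (simp add: bij_betw_imp_surj_on)
      show "shape_operator \<nu> x (e i) = (if e i \<in> C then b else 1) *\<^sub>R e i" if "i \<in> {1..?n}" for i
        using bij_betw_apply[OF e that] SE SF C(1) D(1) by auto
    qed
    then show ?thesis by blast
  qed
  then have "principal_curvatures M \<nu> x (SOME \<kappa>. principal_curvatures M \<nu> x \<kappa>)" (is "principal_curvatures M \<nu> x ?\<kappa>")
    by (rule someI_ex)
  then obtain e where e: "\<And>i j. i \<in> {1..?n} \<Longrightarrow> j \<in> {1..?n} \<Longrightarrow> e i \<bullet> e j = (if i = j then 1 else 0)"
      and span: "span (e ` {1..?n}) = T"
      and eig: "\<And>i. i \<in> {1..?n} \<Longrightarrow> shape_operator \<nu> x (e i) = ?\<kappa> i *\<^sub>R e i"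
    unfolding principal_curvatures_def T(1) by blast
  have cases: "?\<kappa> i = b \<and> e i \<in> E \<or> ?\<kappa> i = 1 \<and> e i \<in> F" if i: "i \<in> {1..?n}" for i
  proof -
    have eT: "e i \<in> T" using span_base[of "e i" "e ` {1..?n}"] i span by auto
    have e0: "e i \<noteq> 0" using e[OF i i] by auto
    obtain u v where u: "u \<in> E" and v: "\<And>w. w \<in> E \<Longrightarrow> orthogonal v w" and uv: "e i = u + v"
      using orthogonal_subspace_decomp_exists[of E "e i"] E(1) by (metis span_eq_iff)
    have "v = e i - u" using uv by simp
    then have vF: "v \<in> F" 
      using v subspace_diff[OF T(2) eT, of u] E(2) u by (auto simp: F orthogonal_commute)
    have "b *\<^sub>R u + v = ?\<kappa> i *\<^sub>R (u + v)"
      using eig[OF i] SE[OF u] SF[OF vF] by (simp add: uv linear_add[OF lin])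
    then have eq: "(b - ?\<kappa> i) *\<^sub>R u = (?\<kappa> i - 1) *\<^sub>R v"
      by (simp add: algebra_simps)
    have uv0: "u \<bullet> v = 0" using v[OF u] by (simp add: orthogonal_def inner_commute)
    have "((b - ?\<kappa> i) *\<^sub>R u) \<bullet> ((b - ?\<kappa> i) *\<^sub>R u) = 0"
      by (subst (2) eq) (simp add: uv0)
    then have "(b - ?\<kappa> i) *\<^sub>R u = 0" by (simp only: inner_eq_zero_iff)
    then have "?\<kappa> i = b \<or> u = 0" "?\<kappa> i = 1 \<or> v = 0"
      using eq by auto
    then show ?thesis using b e0 u vF uv by auto
  qed
  define I where "I = {i \<in> {1..?n}. ?\<kappa> i = b}"
  have I: "I \<subseteq> {1..?n}" "e ` I \<subseteq> E" "e ` ({1..?n} - I) \<subseteq> F"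
    and I1: "\<And>i. i \<in> {1..?n} - I \<Longrightarrow> ?\<kappa> i = 1"
    using cases b unfolding I_def by blast+
  have le: "card J \<le> dim G" if "J \<subseteq> {1..?n}" "e ` J \<subseteq> G" for J G
  proof -
    have "\<And>i j. i \<in> J \<Longrightarrow> j \<in> J \<Longrightarrow> e i \<bullet> e j = (if i = j then 1 else 0)"
      using e that(1) by blast
    note J = orthonormal_family[of J e, OF this]
    show ?thesis
      using independent_card_le_dim[OF that(2) J(2)] J(1) by (simp add: card_image)
  qed
  have "card I \<le> p" "card ({1..?n} - I) \<le> q"
    using le[OF I(1,2)] le[OF _ I(3)] dims by auto
  moreover have "card ({1..?n} - I) = p + q - card I"
    using I(1) dims(3) by (simp add: card_Diff_subset finite_subset)
  moreover have "card I \<le> p + q" using card_mono[OF _ I(1)] dims(3) by simp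
  ultimately have "card I = p" by linarith
  then show ?thesis
    unfolding mean_curvature_def
    by (intro elem_sym_two_values[OF I(1)] I1) (use dims(3) in \<open>auto simp: I_def\<close>)
qed

section \<open>Positivity of the mean curvature polynomial\<close>

lemma choose_Suc_ratio: "real (Suc j) * real (p choose Suc j) = (real p - real j) * real (p choose j)"
proof (cases "j \<le> p")
  case True
  have "Suc j * (p choose Suc j) = (p - j) * (p choose j)"
    using binomial_absorb_comp[of p j] Suc_times_binomial_eq[of "p - 1" j] 
    by (cases p) (auto simp: binomial_absorption)
  then show ?thesis using True by (metis of_nat_diff of_nat_mult)
qed (simp add: binomial_eq_0)

text \<open>As \<open>1 choose (k - j)\<close> vanishes for \<open>j < k - 1\<close>, the sum is
  \<open>b ^ (k - 1)\<close>, an even power, times an affine function of \<open>b\<close>. That function is nondecreasing and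
  still nonnegative at \<open>b = - 1 / (p - 1)\<close>.\<close>

lemma sigma_one_meridian_nonneg:
  fixes b :: real
  assumes "odd k" "3 \<le> k" "k \<le> p + 1" "b \<ge> - 1 / (real p - 1)"
  shows "(\<Sum>j\<le>k. real (p choose j) * real (1 choose (k - j)) * b ^ j) \<ge> 0"
proof -
  obtain i where k: "k = Suc i" and i: "even i" "2 \<le> i" "i \<le> p" using assms by (cases k) auto
  have "(\<Sum>j\<le>k. real (p choose j) * real (1 choose (k - j)) * b ^ j)
      = (\<Sum>j\<in>{i, Suc i}. real (p choose j) * real (1 choose (k - j)) * b ^ j)"
    by (rule sum.mono_neutral_right) (auto simp: k binomial_eq_0)
  also have "\<dots> = b ^ i * (real (p choose i) + real (p choose Suc i) * b)"
    by (simp add: k algebra_simps)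
  also have "\<dots> \<ge> 0"
  proof (rule mult_nonneg_nonneg)
    show "b ^ i \<ge> 0" using i(1) by (simp add: zero_le_even_power)
    have p: "real p - 1 > 0" using i by simp
    have "real (p choose Suc i) \<le> (real p - 1) * real (p choose i)"
    proof -
      have "real (p choose Suc i) * 1 \<le> real (p choose Suc i) * real (Suc i)"
        by (rule mult_left_mono) auto
      also have "\<dots> = (real p - real i) * real (p choose i)"
        using choose_Suc_ratio[of i p] by (simp add: mult.commute)
      also have "\<dots> \<le> (real p - 1) * real (p choose i)"
        by (rule mult_right_mono) (use i in auto)
      finally show ?thesis by simp
    qed
    then have "real (p choose Suc i) * (- 1 / (real p - 1)) \<ge> - real (p choose i)"
      using p by (simp add: field_simps)
    moreover have "real (p choose Suc i) * b \<ge> real (p choose Suc i) * (- 1 / (real p - 1))"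
      by (rule mult_left_mono) (use assms in auto)
    ultimately show "real (p choose i) + real (p choose Suc i) * b \<ge> 0" by linarith
  qed
  finally show ?thesis .
qed

text \<open>The quadratic factor of the sum in the case of two meridian directions, divided by its constant
  term and cleared of denominators, with \<open>i = k - 2\<close>, \<open>m = p - i\<close> and \<open>\<mu> = - b\<close>. In terms of
  \<open>y = \<mu> (m + i - 1)\<close>, which ranges over \<open>[0, 2]\<close>, it is nonincreasing, so only \<open>y = 2\<close> matters. For
  \<open>i = 2\<close> the terms of order two and higher in \<open>m\<close> of \<open>(m + i - 1)\<^sup>2\<close> times the value at \<open>y = 2\<close>
  cancel (leaving \<open>4 (m + 3)\<close>), whence the separate case.\<close>

lemma two_meridian_quadratic_nonneg:
  fixes i m \<mu> :: real
  assumes "i \<ge> 2" "m \<ge> 0" "m * (m - 1) \<ge> 0" "0 \<le> \<mu>" "\<mu> * (m + i - 1) \<le> 2"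
    and i: "i = 2 \<or> i \<ge> 3"
  shows "(i + 2) * (i + 1) - 2 * m * (i + 2) * \<mu> + m * (m - 1) * \<mu>\<^sup>2 \<ge> 0"
proof -
  define D where "D = m + i - 1"
  define y where "y = \<mu> * D"
  have D: "D > 0" using assms by (simp add: D_def)
  have y: "0 \<le> y" "y \<le> 2" using assms D by (auto simp: y_def D_def)
  have at2: "D\<^sup>2 * ((i + 2) * (i + 1)) - 4 * m * (i + 2) * D + 4 * (m * (m - 1)) \<ge> 0"
    using i
  proof
    assume "i = 2"
    then show ?thesis using assms(2) by (simp add: D_def power2_eq_square algebra_simps)
  next
    assume i: "i \<ge> 3"
    have "D * (i + 1) - 4 * m = m * (i - 3) + (i - 1) * (i + 1)"
      by (simp add: D_def algebra_simps)
    also have "\<dots> \<ge> 0" using i assms by simp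
    finally have "D * (i + 2) * (D * (i + 1) - 4 * m) \<ge> 0" using D i by simp
    then show ?thesis using assms(3) by (simp add: algebra_simps power2_eq_square)
  qed
  have mono: "m * (m - 1) * (4 - y\<^sup>2) \<le> 2 * m * (i + 2) * D * (2 - y)"
  proof -
    have "m * (m - 1) * (4 - y\<^sup>2) = m * (2 - y) * ((m - 1) * (2 + y))"
      by (simp add: algebra_simps power2_eq_square)
    also have "\<dots> \<le> m * (2 - y) * (2 * (i + 2) * D)"
    proof (rule mult_left_mono)
      have "(m - 1) * (2 + y) \<le> D * (2 + y)" using assms y by (intro mult_right_mono) (auto simp: D_def)
      also have "\<dots> \<le> D * (2 * (i + 2))" using assms y D by (intro mult_left_mono) auto
      finally show "(m - 1) * (2 + y) \<le> 2 * (i + 2) * D" by (simp add: algebra_simps)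
    qed (use assms y in auto)
    finally show ?thesis by (simp add: algebra_simps)
  qed
  have "D\<^sup>2 * ((i + 2) * (i + 1) - 2 * m * (i + 2) * \<mu> + m * (m - 1) * \<mu>\<^sup>2)
      = D\<^sup>2 * ((i + 2) * (i + 1)) - 2 * m * (i + 2) * D * y + m * (m - 1) * y\<^sup>2"
    by (simp add: y_def algebra_simps power2_eq_square)
  also have "\<dots> \<ge> 0" using at2 mono by (simp add: algebra_simps)
  finally show ?thesis using D by (simp add: zero_le_mult_iff)
qed

text \<open>Here \<open>b ^ (k - 2)\<close> is an even power, and its cofactor is a quadratic polynomial in \<open>b\<close>
  with nonnegative coefficients, so only negative \<open>b\<close> matter. The ratios of consecutive binomial
  coefficients turn the cofactor into the quadratic treated above.\<close>

lemma sigma_two_meridian_nonneg: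
  fixes b :: real
  assumes "even k" "3 \<le> k" "k \<le> p + 2" "b \<ge> - 2 / (real p - 1)"
  shows "(\<Sum>j\<le>k. real (p choose j) * real (2 choose (k - j)) * b ^ j) \<ge> 0"
proof -
  have "4 \<le> k" using assms(1,2) by presburger
  then obtain i where k: "k = Suc (Suc i)" and i: "even i" "2 \<le> i" "i \<le> p"
    using assms by (cases k; cases "k - 1") auto
  define c where "c = real (p choose i)"
  have c1: "(real i + 1) * real (p choose Suc i) = (real p - real i) * c"
    using choose_Suc_ratio[of i p] by (simp add: c_def add.commute)
  have c2: "(real i + 2) * real (p choose Suc (Suc i)) = (real p - real i - 1) * real (p choose Suc i)"
    using choose_Suc_ratio[of "Suc i" p] by (simp add: algebra_simps)
  have "(\<Sum>j\<le>k. real (p choose j) * real (2 choose (k - j)) * b ^ j)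
      = (\<Sum>j\<in>{i, Suc i, Suc (Suc i)}. real (p choose j) * real (2 choose (k - j)) * b ^ j)"
    by (rule sum.mono_neutral_right) (auto simp: k binomial_eq_0)
  also have "\<dots> = b ^ i * (c + 2 * real (p choose Suc i) * b + real (p choose Suc (Suc i)) * b\<^sup>2)"
    by (simp add: k c_def algebra_simps power2_eq_square Suc_diff_le numeral_2_eq_2)
  also have "\<dots> \<ge> 0"
  proof (rule mult_nonneg_nonneg)
    show "b ^ i \<ge> 0" using i(1) by (simp add: zero_le_even_power)
    show "c + 2 * real (p choose Suc i) * b + real (p choose Suc (Suc i)) * b\<^sup>2 \<ge> 0"
    proof (cases "b \<ge> 0")
      case True
      then show ?thesis by (simp add: c_def)
    next
      case False
      define m where "m = real p - real i"
      \<comment> \<open>\<open>m\<close> is an integer, so it avoids the interval where \<open>m (m - 1)\<close> is negative.\<close>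
      have m: "m = real (p - i)" using i by (simp add: m_def of_nat_diff)
      have mm: "m * (m - 1) \<ge> 0" unfolding m by (cases "p - i") auto
      have p: "real p - 1 > 0" using i by simp
      have "(-b) * (m + real i - 1) \<le> 2"
        using assms(4) p by (simp add: m_def field_simps)
      then have "(real i + 2) * (real i + 1) - 2 * m * (real i + 2) * (-b) + m * (m - 1) * (-b)\<^sup>2 \<ge> 0"
        using two_meridian_quadratic_nonneg[of "real i" m "-b"] i mm m False by fastforce
      then have "c * ((real i + 2) * (real i + 1) - 2 * m * (real i + 2) * (-b) + m * (m - 1) * (-b)\<^sup>2) \<ge> 0"
        by (simp add: c_def)
      also have "c * ((real i + 2) * (real i + 1) - 2 * m * (real i + 2) * (-b) + m * (m - 1) * (-b)\<^sup>2)
        = (real i + 2) * (real i + 1) * c + 2 * b * (real i + 2) * (m * c) + b\<^sup>2 * ((m - 1) * (m * c))"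
        by (simp add: algebra_simps power2_eq_square)
      also have "\<dots> = (real i + 2) * (real i + 1) * c + 2 * b * (real i + 2) * ((real i + 1) * real (p choose Suc i))
         + b\<^sup>2 * ((real i + 1) * ((real i + 2) * real (p choose Suc (Suc i))))"
      proof -
        have 1: "m * c = (real i + 1) * real (p choose Suc i)" using c1 by (simp add: m_def)
        then have "(m - 1) * (m * c) = (real i + 1) * ((m - 1) * real (p choose Suc i))" by simp
        then have "(m - 1) * (m * c) = (real i + 1) * ((real i + 2) * real (p choose Suc (Suc i)))"
          unfolding c2 by (simp add: m_def)
        then show ?thesis using 1 by simp
      qed
      also have "\<dots> = (real i + 2) * (real i + 1) *
          (c + 2 * real (p choose Suc i) * b + real (p choose Suc (Suc i)) * b\<^sup>2)"
        by (simp add: algebra_simps)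
      finally have "0 \<le> (real i + 2) * (real i + 1) *
          (c + 2 * real (p choose Suc i) * b + real (p choose Suc (Suc i)) * b\<^sup>2)" .
      moreover have "(real i + 2) * (real i + 1) > 0" by simp
      ultimately show ?thesis by (metis zero_le_mult_iff not_le)
    qed
  qed
  finally show ?thesis .
qed

section \<open>The torus\<close>

lemma sqrt_branch_iff:
  fixes s t h :: real
  assumes "s = 1 \<or> s = -1" "s * t > 0" "h > 0"
  shows "t\<^sup>2 = h \<longleftrightarrow> t = s * sqrt h"
proof
  assume "t\<^sup>2 = h"
  then have "\<bar>t\<bar> = sqrt h" by (metis real_sqrt_abs)
  then show "t = s * sqrt h" using assms by auto
next
  assume "t = s * sqrt h"
  then show "t\<^sup>2 = h" using assms by (auto simp: power_mult_distrib)
qed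

text \<open>Let \<open>A\<close> be a set of coordinate directions. The sphere of radius \<open>R\<close> in the span of \<open>A\<close> is the
  core; the torus is the boundary of the unit tube around it, which is embedded as \<open>R > 1\<close>. The two
  bounds on the number of directions in \<open>A\<close> make the core sphere and the meridian spheres
  connected.\<close>

locale torus =
  fixes A :: "'a::euclidean_space set" and R :: real
  assumes A: "A \<subseteq> Basis" and cardA: "2 \<le> card A" "card A < DIM('a)" and R: "1 < R"
begin

text \<open>\<open>P\<close> and \<open>Q\<close> are the orthogonal projections to the span of \<open>A\<close> and to its complement. The nearest
  core point to \<open>x\<close> is \<open>R *\<^sub>R core_dir x\<close>, and \<open>N\<close> is the gradient of the distance to the core, which
  on the torus is the outward normal. The equation defining \<open>M\<close> avoids \<open>sgn\<close>, whose
  discontinuity where \<open>P x = 0\<close> would get in the way of closedness.\<close>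

definition P :: "'a \<Rightarrow> 'a" where "P x = (\<Sum>b\<in>A. (x \<bullet> b) *\<^sub>R b)"
definition Q :: "'a \<Rightarrow> 'a" where "Q x = x - P x"
definition core_dir :: "'a \<Rightarrow> 'a" where "core_dir x = sgn (P x)"
definition N :: "'a \<Rightarrow> 'a" where "N x = sgn (x - R *\<^sub>R core_dir x)"
definition M :: "'a set" where "M = {x. (norm (P x) - R)\<^sup>2 + (norm (Q x))\<^sup>2 = 1}"

lemma finA: "finite A" using A finite_Basis by (rule finite_subset)

lemma linear_P: "linear P"
  unfolding P_def
  by (intro linear_compose_sum) (auto intro!: linearI simp: inner_add_left scaleR_left_distrib)

lemmas P_add = linear_add[OF linear_P]
  and P_diff = linear_diff[OF linear_P]
  and P_scaleR = linear_scale[OF linear_P]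
  and P_0 = linear_0[OF linear_P]

lemma bounded_linear_P: "bounded_linear P"
  using linear_P by (simp add: linear_conv_bounded_linear)

lemma bounded_linear_Q: "bounded_linear Q"
  unfolding Q_def by (intro bounded_linear_sub bounded_linear_ident bounded_linear_P)

lemma continuous_on_P [continuous_intros]: "continuous_on S f \<Longrightarrow> continuous_on S (\<lambda>x. P (f x))"
  by (rule bounded_linear.continuous_on[OF bounded_linear_P])

lemma continuous_on_Q [continuous_intros]: "continuous_on S f \<Longrightarrow> continuous_on S (\<lambda>x. Q (f x))"
  by (rule bounded_linear.continuous_on[OF bounded_linear_Q])

lemma P_Basis: "b \<in> Basis \<Longrightarrow> P b = (if b \<in> A then b else 0)"
  unfolding P_def using A finA
  by (subst sum.cong[OF refl, of _ _ "\<lambda>c. if c = b then b else 0"])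
    (auto simp: inner_Basis subset_iff)

lemma P_inner: "P x \<bullet> y = x \<bullet> P y"
  by (simp add: P_def inner_sum_left inner_sum_right inner_commute mult.commute)

lemma P_P [simp]: "P (P x) = P x"
proof -
  have "P (P x) = (\<Sum>b\<in>A. (x \<bullet> b) *\<^sub>R P b)"
    unfolding P_def[of x] by (simp add: linear_sum[OF linear_P] P_scaleR)
  also have "\<dots> = P x"
    unfolding P_def[of x] using A by (intro sum.cong) (auto simp: P_Basis)
  finally show ?thesis .
qed

lemma P_Q [simp]: "P (Q x) = 0"
  by (simp add: Q_def P_diff)

lemma P_inner_ker: "P x = x \<Longrightarrow> P y = 0 \<Longrightarrow> x \<bullet> y = 0"
  by (metis P_inner inner_zero_right)

lemma norm_add_ker: "P x = x \<Longrightarrow> P y = 0 \<Longrightarrow> (norm (x + y))\<^sup>2 = (norm x)\<^sup>2 + (norm y)\<^sup>2"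
  using P_inner_ker by (intro norm_add_Pythagorean) (simp add: orthogonal_def)

lemma range_P: "range P = span A"
proof
  have "P x \<in> span A" for x
    unfolding P_def by (intro span_sum span_scale span_base)
  then show "range P \<subseteq> span A" by auto
  have "A \<subseteq> range P" using A P_Basis by (metis rangeI subsetD subsetI)
  then show "span A \<subseteq> range P"
    using span_minimal linear_subspace_image[OF linear_P subspace_UNIV] by blast
qed

lemma in_range_P: "x \<in> range P \<longleftrightarrow> P x = x"
  by (metis P_P rangeE rangeI)

lemma subspace_range_P: "subspace (range P)"
  unfolding range_P by (rule subspace_span)

lemma dim_range_P: "dim (range P) = card A"
  unfolding range_P using A by (simp add: dim_eq_card_independent independent_mono[OF independent_Basis])

lemma norm_core_dir: "P x \<noteq> 0 \<Longrightarrow> norm (core_dir x) = 1"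
  by (simp add: core_dir_def norm_sgn)

lemma P_core_dir [simp]: "P (core_dir x) = core_dir x"
  by (simp add: core_dir_def sgn_div_norm P_scaleR)

lemma P_core: "P x = norm (P x) *\<^sub>R core_dir x"
  by (cases "P x = 0") (simp_all add: core_dir_def sgn_div_norm)

lemma diff_core: "x - R *\<^sub>R core_dir x = (norm (P x) - R) *\<^sub>R core_dir x + Q x"
  using P_core[of x] by (simp add: Q_def algebra_simps)

lemma M_core_nonzero: "x \<in> M \<Longrightarrow> P x \<noteq> 0"
proof
  assume "x \<in> M" "P x = 0"
  then have "R\<^sup>2 \<le> 1" by (auto simp: M_def) (metis le_add_same_cancel1 zero_le_power2)
  then show False using R by (simp add: power2_eq_square) (metis less_1_mult not_le)
qed

lemma M_iff: "x \<in> M \<longleftrightarrow> P x \<noteq> 0 \<and> norm (x - R *\<^sub>R core_dir x) = 1"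
proof (cases "P x = 0")
  case False
  have "(norm (x - R *\<^sub>R core_dir x))\<^sup>2 = (norm (P x) - R)\<^sup>2 + (norm (Q x))\<^sup>2"
    unfolding diff_core using norm_core_dir[OF False]
    by (subst norm_add_ker) (simp_all add: P_scaleR)
  then show ?thesis using False
    by (auto simp: M_def) (metis norm_ge_zero one_power2 power2_eq_imp_eq zero_le_one)
qed (use M_core_nonzero in auto)

text \<open>The polar form of the torus: \<open>a\<close> runs through the directions of the core sphere, and \<open>(c, q)\<close>
  through the meridian unit sphere. As \<open>R + c > 0\<close>, the direction of the point is \<open>a\<close> itself.\<close>

lemma M_param:
  assumes a: "P a = a" "norm a = 1" and q: "P q = 0" and c: "c\<^sup>2 + (norm q)\<^sup>2 = 1"
  shows "R *\<^sub>R a + (c *\<^sub>R a + q) \<in> M"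
proof -
  have "c\<^sup>2 \<le> 1" using c by (metis le_add_same_cancel1 zero_le_power2)
  then have "R + c > 0" using R abs_le_square_iff[of c 1] by auto
  moreover have Px: "P (R *\<^sub>R a + (c *\<^sub>R a + q)) = (R + c) *\<^sub>R a"
    using a q by (simp add: P_add P_scaleR scaleR_add_left)
  moreover have "Q (R *\<^sub>R a + (c *\<^sub>R a + q)) = q"
    unfolding Q_def Px by (simp add: algebra_simps)
  ultimately show ?thesis using a c
    by (simp add: M_def)
qed

lemma M_subset_param:
  assumes "x \<in> M"
  shows "x = R *\<^sub>R core_dir x + ((norm (P x) - R) *\<^sub>R core_dir x + Q x)"
  using diff_core[of x] by (simp add: algebra_simps)

lemma compact_M: "compact M"
proof -
  have "closed M"
    unfolding M_def by (intro closed_Collect_eq continuous_intros)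
  moreover have "norm x \<le> 2 * R + 1" if "x \<in> M" for x
  proof -
    have "norm x \<le> norm (x - R *\<^sub>R core_dir x) + norm (R *\<^sub>R core_dir x)"
      by (metis diff_add_cancel norm_triangle_ineq)
    then show ?thesis using that R norm_core_dir[of x] by (simp add: M_iff)
  qed
  ultimately show ?thesis
    unfolding compact_eq_bounded_closed bounded_iff by blast
qed

text \<open>Both a point of the core sphere and a point of the meridian sphere come from normalising a
  vector, and a linear space of dimension at least two stays connected without its origin.\<close>

lemma connected_M: "connected M"
proof -
  define K where "K = {q. P q = 0}"
  define X where "X = (range P - {0}) \<times> (((UNIV :: real set) \<times> K) - {0})"
  define f where "f = (\<lambda>(a :: 'a, z). R *\<^sub>R sgn a + (fst z *\<^sub>R sgn a + snd z) /\<^sub>R norm z)"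
  have subK: "subspace K" unfolding K_def by (rule linear_subspace_kernel[OF linear_P])
  have "dim K \<noteq> 0"
  proof -
    obtain b where b: "b \<in> Basis" "b \<notin> A" using cardA(2) finA by (metis card_mono linorder_not_le subsetI)
    then have "b \<in> K" "b \<noteq> 0" by (auto simp: K_def P_Basis)
    then show ?thesis by (auto simp: dim_eq_0)
  qed
  then have "aff_dim ((UNIV :: real set) \<times> K) \<noteq> 1"
    using subK by (simp add: aff_dim_subspace subspace_Times dim_Times)
  moreover have "convex ((UNIV :: real set) \<times> K)"
    by (rule subspace_imp_convex) (use subK subspace_Times[OF subspace_UNIV] in blast)
  ultimately have c2: "connected (((UNIV :: real set) \<times> K) - {0})"
    by (intro connected_punctured_convex)
  have "aff_dim (range P) \<noteq> 1"
    using cardA by (simp add: aff_dim_subspace[OF subspace_range_P] dim_range_P)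
  then have "connected (range P - {0})"
    by (intro connected_punctured_convex subspace_imp_convex subspace_range_P)
  then have "connected X" unfolding X_def using c2 by (intro connected_Times)
  moreover have "continuous_on X f"
    unfolding f_def X_def case_prod_unfold by (intro continuous_intros) auto
  moreover have "f ` X = M"
  proof (intro equalityI subsetI)
    fix y assume "y \<in> f ` X"
    then obtain a c q where X: "(a, c, q) \<in> X" and "y = f (a, c, q)"
      by auto
    then have y: "y = R *\<^sub>R sgn a + (c *\<^sub>R sgn a + q) /\<^sub>R norm (c, q)"
      by (simp add: f_def)
    have a: "P a = a" "a \<noteq> 0" and q: "P q = 0" and nz: "(c, q) \<noteq> 0"
      using X unfolding X_def K_def by (simp_all only: mem_Times_iff Diff_iff in_range_P) simp_all
    have "y = R *\<^sub>R sgn a + ((c / norm (c, q)) *\<^sub>R sgn a + q /\<^sub>R norm (c, q))"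
      by (simp add: y scaleR_add_right divide_inverse mult.commute)
    also have "\<dots> \<in> M"
    proof (rule M_param)
      have "(norm (c, q))\<^sup>2 = c\<^sup>2 + (norm q)\<^sup>2" by (simp add: norm_Pair)
      then have "(norm q / norm (c, q))\<^sup>2 + (c / norm (c, q))\<^sup>2 = 1"
        using nz by (simp add: power_divide add.commute zero_prod_def flip: add_divide_distrib)
      moreover have "norm (q /\<^sub>R norm (c, q)) = norm q / norm (c, q)"
        by (simp add: divide_inverse mult.commute)
      ultimately show "(c / norm (c, q))\<^sup>2 + (norm (q /\<^sub>R norm (c, q)))\<^sup>2 = 1"
        by (simp only: add.commute)
    qed (use a q in \<open>auto simp: sgn_div_norm P_scaleR norm_sgn\<close>)
    finally show "y \<in> M" .
  next
    fix y assume y: "y \<in> M"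
    define z where "z = (norm (P y) - R, Q y)"
    have nz: "norm z = 1" using y by (simp add: z_def norm_Pair M_def)
    have "core_dir y \<noteq> 0" using M_core_nonzero[OF y] norm_core_dir[of y] by auto
    then have "(core_dir y, z) \<in> X"
      using nz by (auto simp: X_def in_range_P z_def K_def zero_prod_def)
    moreover have "sgn (core_dir y) = core_dir y"
      using norm_core_dir[OF M_core_nonzero[OF y]] by (simp add: sgn_div_norm)
    then have "f (core_dir y, z) = y"
      using M_subset_param[OF y] nz by (simp add: f_def z_def)
    ultimately show "y \<in> f ` X" by (metis imageI)
  qed
  ultimately show ?thesis by (metis connected_continuous_image)
qed

section \<open>Normal field, tangent spaces and curvature of the torus\<close>

definition regular_domain where "regular_domain = {x. P x \<noteq> 0 \<and> x - R *\<^sub>R core_dir x \<noteq> 0}"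

text \<open>The component of \<open>h\<close> along the core sphere: up to the factor \<open>1 / norm (P x)\<close>, the derivative of
  \<open>core_dir\<close>.\<close>

definition ang :: "'a \<Rightarrow> 'a \<Rightarrow> 'a" where "ang x h = P h - (core_dir x \<bullet> h) *\<^sub>R core_dir x"

lemma M_subset_regular_domain: "M \<subseteq> regular_domain"
  by (auto simp: M_iff regular_domain_def)

lemma smooth_on_core_dir: "smooth_on {x. P x \<noteq> 0} core_dir"
proof -
  have "open {x. P x \<noteq> 0}" by (intro open_Collect_neq continuous_intros)
  then show ?thesis
    unfolding core_dir_def by (intro smooth_on_sgn smooth_on_bounded_linear bounded_linear_P) auto
qed

lemma open_regular_domain: "open regular_domain"
proof -
  have "continuous_on {x. P x \<noteq> 0} (\<lambda>x. x - R *\<^sub>R core_dir x)"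
    by (intro continuous_intros smooth_on_continuous smooth_on_core_dir)
  then have "open ({x. P x \<noteq> 0} \<inter> (\<lambda>x. x - R *\<^sub>R core_dir x) -` (- {0}))"
    using smooth_on_open[OF smooth_on_core_dir] by (intro continuous_open_preimage) auto
  then show ?thesis by (simp add: regular_domain_def Int_def vimage_def)
qed

lemma smooth_on_N: "smooth_on regular_domain N"
proof -
  have "smooth_on regular_domain core_dir"
    by (rule smooth_on_subset[OF smooth_on_core_dir open_regular_domain]) (auto simp: regular_domain_def)
  then have "smooth_on regular_domain (\<lambda>x. x - R *\<^sub>R core_dir x)"
    by (intro smooth_on_diff smooth_on_scaleR[OF smooth_on_const[OF open_regular_domain]]
        smooth_on_bounded_linear[OF open_regular_domain bounded_linear_ident])
  then show ?thesis
    unfolding N_def by (rule smooth_on_sgn) (auto simp: regular_domain_def)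
qed

lemma core_dir_has_derivative:
  assumes "P x \<noteq> 0"
  shows "(core_dir has_derivative (\<lambda>h. ang x h /\<^sub>R norm (P x))) (at x)"
proof -
  have "core_dir x \<bullet> P h = core_dir x \<bullet> h" for h
    by (metis P_core_dir P_inner)
  then show ?thesis
    using has_derivative_sgn[OF bounded_linear_imp_has_derivative[OF bounded_linear_P] assms]
    unfolding core_dir_def ang_def by simp
qed

lemma P_ang [simp]: "P (ang x h) = ang x h"
  by (simp add: ang_def P_diff P_scaleR)

lemma core_dir_ang: "P x \<noteq> 0 \<Longrightarrow> core_dir x \<bullet> ang x h = 0"
  using norm_core_dir[of x] P_inner[of "core_dir x" h]
  by (simp add: ang_def inner_diff_right norm_eq_1)

lemma N_M: "x \<in> M \<Longrightarrow> N x = (norm (P x) - R) *\<^sub>R core_dir x + Q x"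
  by (simp add: N_def M_iff sgn_div_norm flip: diff_core)

lemma norm_N: "x \<in> regular_domain \<Longrightarrow> norm (N x) = 1"
  by (simp add: N_def regular_domain_def norm_sgn)

lemma N_ang: "x \<in> M \<Longrightarrow> N x \<bullet> ang x h = 0"
  using M_core_nonzero[of x] P_inner_ker[of "ang x h" "Q x"]
  by (simp add: N_M inner_add_left core_dir_ang inner_commute[of "Q x"])

lemma offset_has_derivative:
  assumes "P x \<noteq> 0"
  shows "((\<lambda>x. x - R *\<^sub>R core_dir x) has_derivative (\<lambda>h. h - (R / norm (P x)) *\<^sub>R ang x h)) (at x)"
proof -
  have "((\<lambda>x. x - R *\<^sub>R core_dir x) has_derivative (\<lambda>h. h - R *\<^sub>R (ang x h /\<^sub>R norm (P x)))) (at x)"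
    by (intro has_derivative_diff has_derivative_ident has_derivative_scaleR_right
        core_dir_has_derivative assms)
  then show ?thesis by (simp add: divide_inverse)
qed

lemma N_has_derivative:
  assumes "x \<in> M"
  shows "(N has_derivative (\<lambda>h. h - (R / norm (P x)) *\<^sub>R ang x h - (N x \<bullet> h) *\<^sub>R N x)) (at x)"
proof -
  have x: "P x \<noteq> 0" "norm (x - R *\<^sub>R core_dir x) = 1" "x - R *\<^sub>R core_dir x \<noteq> 0"
    using assms by (auto simp: M_iff)
  show ?thesis
    using has_derivative_sgn[OF offset_has_derivative[OF x(1)] x(3)] x(2) N_ang[OF assms]
    unfolding N_def[symmetric] by (simp add: inner_diff_right)
qed

text \<open>The distance to the core is constant along a curve in the torus, so its gradient \<open>N x\<close> is
  orthogonal to the velocity.\<close>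

lemma tangent_space_subset:
  assumes x: "x \<in> M" and v: "v \<in> tangent_space M x"
  shows "N x \<bullet> v = 0"
proof -
  obtain \<gamma> \<epsilon> where e: "0 < \<epsilon>" and \<gamma>: "\<gamma> ` {-\<epsilon><..<\<epsilon>} \<subseteq> M" "\<gamma> 0 = x"
    and der: "(\<gamma> has_vector_derivative v) (at 0)"
    using v by (auto simp: tangent_space_def)
  let ?d = "\<lambda>x. norm (x - R *\<^sub>R core_dir x)"
  have nz: "P x \<noteq> 0" "x - R *\<^sub>R core_dir x \<noteq> 0" "norm (x - R *\<^sub>R core_dir x) = 1"
    using x by (auto simp: M_iff)
  have "(?d has_derivative (\<lambda>h. (h - (R / norm (P x)) *\<^sub>R ang x h) \<bullet> sgn (x - R *\<^sub>R core_dir x))) (at x)"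
    using has_derivative_compose[OF offset_has_derivative[OF nz(1)] has_derivative_norm[OF nz(2)]] .
  then have "(?d has_derivative (\<lambda>h. N x \<bullet> h)) (at (\<gamma> 0))"
    using N_ang[OF x] unfolding N_def[symmetric] \<gamma>(2)
    by (simp add: inner_diff_right inner_commute[of _ "N x"])
  moreover have "(\<gamma> has_derivative (\<lambda>t. t *\<^sub>R v)) (at 0)"
    using der by (simp add: has_vector_derivative_def)
  ultimately have "((\<lambda>t. ?d (\<gamma> t)) has_derivative (\<lambda>t. N x \<bullet> (t *\<^sub>R v))) (at 0)"
    by (rule has_derivative_compose[rotated])
  moreover have "((\<lambda>t. ?d (\<gamma> t)) has_derivative (\<lambda>t. 0)) (at 0)"
  proof (rule has_derivative_transform_within_open[of "\<lambda>t. 1" _ _ _ "{-\<epsilon><..<\<epsilon>}"])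
    show "1 = ?d (\<gamma> t)" if "t \<in> {-\<epsilon><..<\<epsilon>}" for t
      using \<gamma>(1) that by (auto simp: M_iff image_subset_iff)
  qed (use e in auto)
  ultimately have "(\<lambda>t. N x \<bullet> (t *\<^sub>R v)) = (\<lambda>t. 0)"
    by (rule has_derivative_unique)
  then show ?thesis by (metis scaleR_one)
qed

text \<open>Moving to distance one from the nearest core point retracts a neighbourhood onto the torus.\<close>

lemma retraction_in_M:
  assumes "y \<in> regular_domain"
  shows "R *\<^sub>R core_dir y + N y \<in> M"
proof -
  let ?d = "norm (y - R *\<^sub>R core_dir y)"
  have nz: "P y \<noteq> 0" "?d \<noteq> 0" using assms by (auto simp: regular_domain_def)
  have N: "N y = ((norm (P y) - R) / ?d) *\<^sub>R core_dir y + Q y /\<^sub>R ?d"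
    unfolding N_def sgn_div_norm
    by (subst (2) diff_core) (simp add: scaleR_add_right divide_inverse mult.commute)
  have PQd: "P (Q y /\<^sub>R ?d) = 0" by (simp add: P_scaleR)
  have "(norm (N y))\<^sup>2 = ((norm (P y) - R) / ?d)\<^sup>2 + (norm (Q y /\<^sub>R ?d))\<^sup>2"
    unfolding N using norm_core_dir[OF nz(1)] PQd
    by (subst norm_add_ker) (simp_all add: P_scaleR power_divide)
  then have "((norm (P y) - R) / ?d)\<^sup>2 + (norm (Q y /\<^sub>R ?d))\<^sup>2 = 1"
    by (simp only: norm_N[OF assms] one_power2)
  then show ?thesis
    unfolding N by (rule M_param[OF P_core_dir norm_core_dir[OF nz(1)] PQd])
qed

text \<open>Conversely, retracting the line \<open>x + t *\<^sub>R v\<close> to the torus gives a smooth curve. Its velocity is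
  \<open>v - (N x \<bullet> v) *\<^sub>R N x\<close>, because the derivative of \<open>N\<close> cancels that of the core point.\<close>

lemma tangent_space_M:
  assumes x: "x \<in> M"
  shows "tangent_space M x = {v. N x \<bullet> v = 0}"
proof (intro equalityI subsetI)
  show "v \<in> {v. N x \<bullet> v = 0}" if "v \<in> tangent_space M x" for v
    using tangent_space_subset[OF x that] by simp
next
  fix v assume v: "v \<in> {v. N x \<bullet> v = 0}"
  define y where "y = (\<lambda>t :: real. x + t *\<^sub>R v)"
  define \<gamma> where "\<gamma> = (\<lambda>t. R *\<^sub>R core_dir (y t) + N (y t))"
  have x_reg: "x \<in> regular_domain" "P x \<noteq> 0" using x M_subset_regular_domain M_core_nonzero by auto
  have "open (y -` regular_domain)"
    unfolding y_def by (intro open_vimage open_regular_domain continuous_intros)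
  moreover have "0 \<in> y -` regular_domain" using x_reg by (simp add: y_def)
  ultimately obtain \<epsilon> where e: "\<epsilon> > 0" "ball 0 \<epsilon> \<subseteq> y -` regular_domain" by (rule openE)
  have ball: "ball 0 \<epsilon> = {-\<epsilon><..<\<epsilon>}" by (auto simp: dist_norm)
  have y_reg: "y t \<in> regular_domain" if "t \<in> ball 0 \<epsilon>" for t using e that by auto
  have sy: "smooth_on (ball 0 \<epsilon>) y"
    unfolding y_def
    by (intro smooth_on_add smooth_on_const smooth_on_bounded_linear open_ball
        bounded_linear_scaleR_left)
  have "smooth_on (ball 0 \<epsilon>) (\<lambda>t. P x + t *\<^sub>R P v)"
    by (intro smooth_on_add smooth_on_const smooth_on_bounded_linear open_ball
        bounded_linear_scaleR_left)
  then have sP: "smooth_on (ball 0 \<epsilon>) (\<lambda>t. P (y t))" by (simp add: y_def P_add P_scaleR)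
  have sc: "smooth_on (ball 0 \<epsilon>) (\<lambda>t. core_dir (y t))"
    unfolding core_dir_def by (rule smooth_on_sgn[OF sP]) (use y_reg in \<open>auto simp: regular_domain_def\<close>)
  have "smooth_on (ball 0 \<epsilon>) (\<lambda>t. N (y t))"
    unfolding N_def
    by (intro smooth_on_sgn smooth_on_diff sy smooth_on_scaleR smooth_on_const open_ball sc)
      (use y_reg in \<open>auto simp: regular_domain_def\<close>)
  then have "smooth_on (ball 0 \<epsilon>) \<gamma>"
    unfolding \<gamma>_def by (intro smooth_on_add smooth_on_scaleR smooth_on_const open_ball sc)
  moreover have "\<gamma> ` ball 0 \<epsilon> \<subseteq> M"
    using retraction_in_M y_reg by (auto simp: \<gamma>_def)
  moreover have "\<gamma> 0 = x"
    using x by (simp add: \<gamma>_def y_def N_def M_iff sgn_div_norm)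
  moreover have "(\<gamma> has_vector_derivative v) (at 0)"
  proof -
    have dy: "(y has_derivative (\<lambda>t. t *\<^sub>R v)) (at 0)"
      unfolding y_def by (auto intro!: derivative_eq_intros)
    have y0: "y 0 = x" by (simp add: y_def)
    have ang_scale: "ang x (t *\<^sub>R v) = t *\<^sub>R ang x v" for t
      by (simp add: ang_def P_scaleR algebra_simps)
    have "(\<gamma> has_derivative (\<lambda>t. R *\<^sub>R (ang x (t *\<^sub>R v) /\<^sub>R norm (P x)) +
      (t *\<^sub>R v - (R / norm (P x)) *\<^sub>R ang x (t *\<^sub>R v) - (N x \<bullet> (t *\<^sub>R v)) *\<^sub>R N x))) (at 0)"
      unfolding \<gamma>_def
      by (intro has_derivative_add has_derivative_scaleR_right
          has_derivative_compose[OF dy, of core_dir, unfolded y0]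
          has_derivative_compose[OF dy, of N, unfolded y0]
          core_dir_has_derivative N_has_derivative x x_reg)
    then show ?thesis
      using v by (simp add: has_vector_derivative_def divide_inverse)
  qed
  ultimately show "v \<in> tangent_space M x"
    unfolding tangent_space_def ball using e(1) by blast
qed

lemma unit_normal_field_M: "unit_normal_field M (\<lambda>x. - N x)"
  unfolding unit_normal_field_def
proof (intro conjI exI ballI)
  show "M \<subseteq> regular_domain" by (rule M_subset_regular_domain)
  show "smooth_on regular_domain (\<lambda>x. - N x)"
    using smooth_on_diff[OF smooth_on_const[OF open_regular_domain, of 0] smooth_on_N] by simp
  show "norm (- N x) = 1" if "x \<in> M" for x using that M_subset_regular_domain norm_N by auto
  show "- N x \<bullet> v = 0" if "x \<in> M" "v \<in> tangent_space M x" for x v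
    using tangent_space_subset[OF that] by simp
qed

text \<open>By the derivative of \<open>N\<close>, the shape operator subtracts \<open>R / norm (P x)\<close> times the component along
  the core sphere. It acts on the directions tangent to the core sphere as the scalar
  \<open>1 - R / norm (P x)\<close>, and fixes the tangent vectors orthogonal to these, the meridian ones.\<close>

lemma mean_curvature_M:
  assumes x: "x \<in> M"
  shows "mean_curvature k M (\<lambda>x. - N x) x =
    (\<Sum>j\<le>k. real (card A - 1 choose j) * real (DIM('a) - card A choose (k - j)) * (1 - R / norm (P x)) ^ j)"
proof -
  let ?c = "core_dir x"
  have nz: "P x \<noteq> 0" by (rule M_core_nonzero[OF x])
  have c: "norm ?c = 1" "?c \<in> range P" by (simp_all add: norm_core_dir[OF nz] in_range_P)
  define T where "T = {v. N x \<bullet> v = 0}"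
  define E where "E = {v \<in> range P. \<forall>u\<in>span {?c}. orthogonal u v}"
  define F where "F = {v \<in> T. \<forall>u\<in>E. orthogonal u v}"
  have E_iff: "v \<in> E \<longleftrightarrow> P v = v \<and> ?c \<bullet> v = 0" for v
    unfolding E_def by (auto simp: in_range_P orthogonal_def span_singleton)
  have S: "shape_operator (\<lambda>x. - N x) x h = h - (R / norm (P x)) *\<^sub>R ang x h - (N x \<bullet> h) *\<^sub>R N x" for h
    unfolding shape_operator_def
    by (subst frechet_derivative_at[OF has_derivative_minus[OF N_has_derivative[OF x]], symmetric]) simp
  have E_T: "E \<subseteq> T"
  proof
    fix v assume v: "v \<in> E"
    then have "v = ang x v" unfolding E_iff by (simp add: ang_def)
    then show "v \<in> T" using N_ang[OF x] unfolding T_def by (metis mem_Collect_eq)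
  qed
  have subT: "subspace T" unfolding T_def by (rule subspace_hyperplane)
  have subE: "subspace E"
    by (rule subspaceI) (auto simp: E_iff P_0 P_add P_scaleR inner_add_right)
  have "dim (span {?c}) = 1"
    using c(1) by (subst dim_span) (auto simp: dim_eq_card_independent)
  moreover have "dim E + dim (span {?c}) = dim (range P)"
    unfolding E_def
    by (rule dim_subspace_orthogonal_to_vectors[OF subspace_span subspace_range_P])
      (use c(2) in \<open>simp add: span_minimal subspace_range_P\<close>)
  ultimately have dimE: "dim E = card A - 1" by (simp add: dim_range_P)
  have "N x \<noteq> 0" using norm_N[of x] x M_subset_regular_domain by force
  then have "dim T = DIM('a) - 1" unfolding T_def by (rule dim_hyperplane)
  then have dimF: "dim F = DIM('a) - card A"
    using dim_subspace_orthogonal_to_vectors[OF subE subT E_T] dimE cardA by (simp add: F_def)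
  show ?thesis
  proof (rule mean_curvature_two_values[OF tangent_space_M[OF x, folded T_def] subT subE E_T F_def dimE dimF])
    show "DIM('a) - 1 = card A - 1 + (DIM('a) - card A)" using cardA by simp
    show "linear (shape_operator (\<lambda>x. - N x) x)"
      using has_derivative_linear[OF N_has_derivative[OF x]] unfolding S[abs_def] .
    show "shape_operator (\<lambda>x. - N x) x v = (1 - R / norm (P x)) *\<^sub>R v" if v: "v \<in> E" for v
    proof -
      have "ang x v = v" "N x \<bullet> v = 0" using v E_T by (auto simp: E_iff ang_def T_def)
      then show ?thesis by (simp add: S algebra_simps)
    qed
    show "shape_operator (\<lambda>x. - N x) x v = v" if v: "v \<in> F" for v
    proof -
      have "ang x v \<in> E" by (simp add: E_iff core_dir_ang[OF nz])
      then have "ang x v \<bullet> v = 0" using v by (simp add: F_def orthogonal_def)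
      then have "ang x v \<bullet> P v = 0" by (metis P_inner P_ang)
      then have "ang x v \<bullet> ang x v = 0"
        by (subst (2) ang_def) (simp add: inner_diff_right core_dir_ang[OF nz] inner_commute[of _ ?c])
      moreover have "N x \<bullet> v = 0" using v by (simp add: F_def T_def)
      ultimately show ?thesis by (simp add: S)
    qed
    show "1 - R / norm (P x) \<noteq> 1" using R nz by simp
  qed
qed

section \<open>Charts of the torus\<close>

text \<open>Solving the equation of the torus for one coordinate presents it locally as a graph. Where
  \<open>Q x \<noteq> 0\<close>, a nonzero coordinate outside \<open>A\<close> will do. Otherwise \<open>norm (P x) = R \<plusminus> 1\<close>; there
  \<open>norm (P y) = R \<plusminus> sqrt (1 - Q y \<bullet> Q y)\<close> holds nearby on the torus, and squaring allows to solve for a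
  nonzero coordinate in \<open>A\<close>.\<close>

lemma smooth_hypersurface_M: "smooth_hypersurface M"
  unfolding smooth_hypersurface_def
proof
  fix x assume x: "x \<in> M"
  note smooth = smooth_on_diff smooth_on_mult smooth_on_inner smooth_on_add
  show "\<exists>U V \<phi> \<psi>. \<exists>b\<in>(Basis :: 'a set).
        open U \<and> open V \<and> x \<in> U \<and>
        homeomorphism U V \<phi> \<psi> \<and> smooth_on U \<phi> \<and> smooth_on V \<psi> \<and>
        \<phi> ` (M \<inter> U) = {y \<in> V. y \<bullet> b = 0}"
  proof (cases "Q x = 0")
    case False
    then obtain b where b: "b \<in> Basis" "Q x \<bullet> b \<noteq> 0"
      by (metis euclidean_all_zero_iff)
    have bA: "b \<notin> A"
      using b P_inner_ker[of b "Q x"] by (auto simp: P_Basis inner_commute)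
    then have Pb: "P b = 0" using b by (simp add: P_Basis)
    have Qb: "Q y \<bullet> b = y \<bullet> b" for y
      using Pb by (simp add: Q_def inner_diff_left P_inner)
    define Z where "Z y = Q y - (y \<bullet> b) *\<^sub>R b" for y
    define h where "h y = 1 - (norm (P y) - R) * (norm (P y) - R) - Z y \<bullet> Z y" for y
    define s where "s = sgn (x \<bullet> b)"
    have s: "s = 1 \<or> s = -1" "s * (x \<bullet> b) > 0"
      using b(2) by (auto simp: s_def Qb sgn_if)
    have linZ: "bounded_linear Z"
      unfolding Z_def[abs_def]
      by (intro bounded_linear_sub bounded_linear_Q
          bounded_linear_compose[OF bounded_linear_scaleR_left bounded_linear_inner_left])
    define V where "V = {y. P y \<noteq> 0 \<and> h y > 0}"
    define U where "U = {y \<in> V. s * (y \<bullet> b) > 0}"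
    have cont_h: "continuous_on UNIV h"
      unfolding h_def[abs_def]
      by (intro continuous_intros linear_continuous_on linZ)
    have oV: "open V"
      unfolding V_def by (intro open_Collect_conj open_Collect_neq open_Collect_less continuous_intros cont_h)
    have oU: "open U"
      unfolding U_def by (intro open_Collect_conj open_Collect_less continuous_intros)
        (use oV in simp)
    have decomp: "(norm (Q y))\<^sup>2 = Z y \<bullet> Z y + (y \<bullet> b)\<^sup>2" for y
      using b(1) Qb[of y] by (simp add: Z_def power2_norm_eq_inner inner_diff_left inner_diff_right
          inner_commute[of b "Q y"] power2_eq_square[of "y \<bullet> b"])
    have M_h: "y \<in> M \<longleftrightarrow> (y \<bullet> b)\<^sup>2 = h y" for y
      unfolding M_def mem_Collect_eq decomp h_def by (auto simp: power2_eq_square)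
    have hx: "h x > 0" using M_h[of x] x b(2) by (metis Qb zero_less_power2)
    have "smooth_on V P" "smooth_on V Z"
      by (intro smooth_on_bounded_linear oV bounded_linear_P linZ)+
    then have "smooth_on V h"
      unfolding h_def[abs_def]
      by (intro smooth smooth_on_const oV smooth_on_norm) (auto simp: V_def)
    then have g: "smooth_on V (\<lambda>y. s * sqrt (h y))"
      by (intro smooth_on_mult smooth_on_const oV smooth_on_sqrt) (auto simp: V_def)
    show ?thesis
    proof (rule graph_slice_chart[OF b(1) g oU])
      show "U \<subseteq> V" by (auto simp: U_def)
      show "x \<in> U" using s hx x M_core_nonzero by (simp add: U_def V_def)
      show "y + t *\<^sub>R b \<in> V \<and> s * sqrt (h (y + t *\<^sub>R b)) = s * sqrt (h y)" if "y \<in> V" for y t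
      proof -
        have P: "P (y + t *\<^sub>R b) = P y" by (simp add: P_add P_scaleR Pb)
        then have "Z (y + t *\<^sub>R b) = Z y"
          using b(1) by (simp add: Z_def Q_def inner_add_left algebra_simps)
        then show ?thesis using that P by (simp add: V_def h_def)
      qed
      show "M \<inter> U = {y \<in> U. y \<bullet> b = s * sqrt (h y)}"
        using sqrt_branch_iff[OF s(1)] M_h by (auto simp: U_def V_def)
    qed
  next
    case True
    obtain b where b: "b \<in> Basis" "P x \<bullet> b \<noteq> 0"
      using M_core_nonzero[OF x] by (metis euclidean_all_zero_iff)
    have bA: "b \<in> A"
      using b by (metis P_Basis P_inner inner_zero_right)
    then have Pb: "P b = b" using b by (simp add: P_Basis)
    have Pyb: "P y \<bullet> b = y \<bullet> b" for y
      using Pb by (simp add: P_inner)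
    define Z where "Z y = P y - (y \<bullet> b) *\<^sub>R b" for y
    define r where "r = sgn (norm (P x) - R)"
    define s where "s = sgn (x \<bullet> b)"
    define c where "c y = R + r * sqrt (1 - Q y \<bullet> Q y)" for y
    define h where "h y = c y * c y - Z y \<bullet> Z y" for y
    have s: "s = 1 \<or> s = -1" "s * (x \<bullet> b) > 0"
      using b(2) by (auto simp: s_def Pyb sgn_if)
    have "norm (P x) - R \<noteq> 0" using x True by (auto simp: M_def)
    then have r: "r = 1 \<or> r = -1" "r * (norm (P x) - R) > 0"
      by (auto simp: r_def sgn_if)
    have linZ: "bounded_linear Z"
      unfolding Z_def[abs_def]
      by (intro bounded_linear_sub bounded_linear_P
          bounded_linear_compose[OF bounded_linear_scaleR_left bounded_linear_inner_left])
    define V where "V = {y. 0 < 1 - Q y \<bullet> Q y \<and> h y > 0}"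
    define U where "U = {y \<in> V. s * (y \<bullet> b) > 0 \<and> r * (norm (P y) - R) > 0}"
    have cont_h: "continuous_on UNIV h"
      unfolding h_def[abs_def] c_def[abs_def]
      by (intro continuous_intros linear_continuous_on linZ)
    have oV: "open V"
      unfolding V_def by (intro open_Collect_conj open_Collect_less continuous_intros cont_h)
    have oU: "open U"
      unfolding U_def by (intro open_Collect_conj open_Collect_less continuous_intros)
        (use oV in simp)
    have decomp: "(norm (P y))\<^sup>2 = Z y \<bullet> Z y + (y \<bullet> b)\<^sup>2" for y
      using b(1) Pyb[of y] by (simp add: Z_def power2_norm_eq_inner inner_diff_left inner_diff_right
          inner_commute[of b "P y"] power2_eq_square[of "y \<bullet> b"])
    have M_h: "y \<in> M \<longleftrightarrow> (y \<bullet> b)\<^sup>2 = h y"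
      if q: "0 < 1 - Q y \<bullet> Q y" and sheet: "r * (norm (P y) - R) > 0" for y
    proof -
      have "1 - Q y \<bullet> Q y \<le> 1" by simp
      then have "sqrt (1 - Q y \<bullet> Q y) \<le> 1" by simp
      moreover have "0 \<le> sqrt (1 - Q y \<bullet> Q y)" using q by simp
      ultimately have cpos: "c y > 0" using r(1) R
        unfolding c_def by (elim disjE; simp only:; linarith)
      have "y \<in> M \<longleftrightarrow> (norm (P y) - R)\<^sup>2 = 1 - Q y \<bullet> Q y"
        by (auto simp: M_def power2_norm_eq_inner)
      also have "\<dots> \<longleftrightarrow> norm (P y) - R = r * sqrt (1 - Q y \<bullet> Q y)"
        by (rule sqrt_branch_iff[OF r(1) sheet q])
      also have "\<dots> \<longleftrightarrow> norm (P y) = c y" by (auto simp: c_def)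
      also have "\<dots> \<longleftrightarrow> (norm (P y))\<^sup>2 = (c y)\<^sup>2"
        using cpos by (simp add: power2_eq_iff_nonneg)
      also have "\<dots> \<longleftrightarrow> (y \<bullet> b)\<^sup>2 = h y"
        unfolding decomp h_def by (auto simp: power2_eq_square)
      finally show ?thesis .
    qed
    have Qx: "0 < 1 - Q x \<bullet> Q x" using True by simp
    have hx: "h x > 0" using M_h[OF Qx r(2)] x b(2) by (metis Pyb zero_less_power2)
    have Q: "smooth_on V Q" and Z: "smooth_on V Z"
      by (intro smooth_on_bounded_linear oV bounded_linear_Q linZ)+
    have "smooth_on V c"
      unfolding c_def[abs_def]
      by (intro smooth smooth_on_const oV smooth_on_sqrt Q) (auto simp: V_def)
    then have "smooth_on V h"
      unfolding h_def[abs_def] by (intro smooth Z)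
    then have g: "smooth_on V (\<lambda>y. s * sqrt (h y))"
      by (intro smooth_on_mult smooth_on_const oV smooth_on_sqrt) (auto simp: V_def)
    show ?thesis
    proof (rule graph_slice_chart[OF b(1) g oU])
      show "U \<subseteq> V" by (auto simp: U_def)
      show "x \<in> U" using s r hx Qx by (simp add: U_def V_def)
      show "y + t *\<^sub>R b \<in> V \<and> s * sqrt (h (y + t *\<^sub>R b)) = s * sqrt (h y)" if "y \<in> V" for y t
      proof -
        have P: "P (y + t *\<^sub>R b) = P y + t *\<^sub>R b" by (simp add: P_add P_scaleR Pb)
        then have "Q (y + t *\<^sub>R b) = Q y" "Z (y + t *\<^sub>R b) = Z y"
          using b(1) by (simp_all add: Z_def Q_def inner_add_left algebra_simps)
        then show ?thesis using that by (simp add: V_def h_def c_def)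
      qed
      show "M \<inter> U = {y \<in> U. y \<bullet> b = s * sqrt (h y)}"
        using sqrt_branch_iff[OF s(1)] M_h by (auto simp: U_def V_def)
    qed
  qed
qed

lemma closed_hypersurface_M: "closed_hypersurface M"
  unfolding closed_hypersurface_def
  using smooth_hypersurface_M compact_M connected_M by blast

section \<open>Sign of the mean curvatures\<close>

lemma norm_P_ge: "x \<in> M \<Longrightarrow> R - 1 \<le> norm (P x)"
proof -
  assume "x \<in> M"
  then have "(norm (P x) - R)\<^sup>2 \<le> 1"
    by (auto simp: M_def) (metis le_add_same_cancel1 zero_le_power2)
  then have "\<bar>norm (P x) - R\<bar> \<le> 1" using abs_le_square_iff[of "norm (P x) - R" 1] by simp
  then show ?thesis by linarith
qed

lemma equator_points:
  assumes "c = 1 \<or> c = -1"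
  obtains x where "x \<in> M" "norm (P x) = R + c"
proof -
  obtain b where b: "b \<in> A" using cardA by fastforce
  then have "P b = b" "norm b = 1" using A P_Basis by auto
  then have "P ((R + c) *\<^sub>R b) = (R + c) *\<^sub>R b" "norm ((R + c) *\<^sub>R b) = R + c"
    using assms R by (auto simp: P_scaleR)
  then show ?thesis
    using assms by (intro that[of "(R + c) *\<^sub>R b"]) (auto simp: M_def Q_def)
qed

lemma mean_curvature_1_M:
  assumes "x \<in> M"
  shows "mean_curvature 1 M (\<lambda>x. - N x) x =
    real (DIM('a) - card A) + real (card A - 1) * (1 - R / norm (P x))"
  by (simp add: mean_curvature_M[OF assms] atMost_Suc)

end

theorem mainTheorem6:
  fixes n k :: nat
  assumes "3 \<le> k" and "k \<le> n" and "CARD('m::finite) = n + 1"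
  shows "\<exists>(M :: (real ^ 'm) set) \<nu>.
           closed_hypersurface M \<and> unit_normal_field M \<nu> \<and>
           (\<forall>p\<in>M. mean_curvature k M \<nu> p \<ge> 0) \<and>
           (\<exists>p\<in>M. mean_curvature 1 M \<nu> p > 0) \<and>
           (\<exists>p\<in>M. mean_curvature 1 M \<nu> p < 0)"
proof -
  define q where "q = (if odd k then 1 else 2 :: nat)"
  define p where "p = n - q"
  have "even k \<Longrightarrow> 4 \<le> k" using assms(1) by presburger
  then have p: "2 \<le> p" "k \<le> p + q" "n = p + q" and q: "q \<ge> 1"
    using assms by (auto simp: p_def q_def)
  have dim: "DIM(real ^ 'm) = p + q + 1" using assms(3) p(3) by simp
  \<comment> \<open>With this radius the smallest core curvature \<open>- 1 / (R - 1)\<close> equals \<open>- q / (p - 1)\<close>.\<close>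
  define R where "R = 1 + (real p - 1) / real q"
  have pq: "(real p - 1) / real q > 0" using p q by simp
  obtain A :: "(real ^ 'm) set" where axes: "A \<subseteq> Basis" "card A = p + 1"
    using obtain_subset_with_card_n[of "p + 1" "Basis :: (real ^ 'm) set"] dim by auto
  interpret torus A R
    by unfold_locales (use axes dim p q pq in \<open>auto simp: R_def\<close>)
  have codim: "DIM(real ^ 'm) - card A = q" "card A - 1 = p" using dim axes by auto
  have ratio: "1 - R / (R - 1) = - real q / (real p - 1)"
    using p q by (simp add: R_def field_simps)
  have "mean_curvature k M (\<lambda>x. - N x) x \<ge> 0" if x: "x \<in> M" for x
  proof -
    have "R / norm (P x) \<le> R / (R - 1)"
      using norm_P_ge[OF x] R by (intro divide_left_mono) (auto intro!: mult_pos_pos simp: M_core_nonzero[OF x])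
    then have b: "1 - R / norm (P x) \<ge> - real q / (real p - 1)" using ratio by linarith
    show ?thesis
    proof (cases "odd k")
      case True
      then show ?thesis
        using sigma_one_meridian_nonneg[of k p "1 - R / norm (P x)"] b p assms(1)
        unfolding mean_curvature_M[OF x] codim by (simp add: q_def)
    next
      case False
      then show ?thesis
        using sigma_two_meridian_nonneg[of k p "1 - R / norm (P x)"] b p assms(1)
        unfolding mean_curvature_M[OF x] codim by (simp add: q_def)
    qed
  qed
  moreover have "\<exists>x\<in>M. mean_curvature 1 M (\<lambda>x. - N x) x > 0"
  proof -
    obtain x where x: "x \<in> M" "norm (P x) = R + 1" using equator_points[of 1] by auto
    have "1 - R / (R + 1) \<ge> 0" using R by (simp add: field_simps)
    then have "real q + real p * (1 - R / (R + 1)) > 0" using q by (intro add_pos_nonneg) auto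
    then have "mean_curvature 1 M (\<lambda>x. - N x) x > 0"
      unfolding mean_curvature_1_M[OF x(1)] codim x(2) .
    then show ?thesis using x(1) by blast
  qed
  moreover have "\<exists>x\<in>M. mean_curvature 1 M (\<lambda>x. - N x) x < 0"
  proof -
    obtain x where x: "x \<in> M" "norm (P x) = R - 1" using equator_points[of "-1"] by auto
    have "real q + real p * (- real q / (real p - 1)) = - real q / (real p - 1)"
      using p by (simp add: field_simps)
    also have "\<dots> < 0" using p q by simp
    finally have "mean_curvature 1 M (\<lambda>x. - N x) x < 0"
      unfolding mean_curvature_1_M[OF x(1)] codim x(2) ratio .
    then show ?thesis using x(1) by blast
  qed
  ultimately show ?thesis
    using closed_hypersurface_M unit_normal_field_M by blast
qed

end
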